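(* Let $K$ be an origin-symmetric star body in $\mathbb{R}^n$ and let $\epsilon\in(0,n)$. If the space $(\mathbb{R}^n,\|\cdot\|_K)$ embeds in $L_{-p}$ for every $p\in(0,\epsilon)$, then it also embeds in $L_0$.
   Context: An origin-symmetric star body in $\mathbb{R}^n$ is a compact set $K$, symmetric about the origin, such that every straight line through the origin crosses the boundary of $K$ at exactly two points, the boundary is continuous (i.e. the radial function $x\mapsto\|x\|_K^{-1}$ is continuous on $S^{n-1}$), and the origin is an interior point of $K$. Its Minkowski functional is $\|x\|_K=\min\{a\ge 0: x\in aK\}$. The space $(\mathbb{R}^n,\|\cdot\|_K)$ embeds in $L_0$ if there exist a finite Borel (non-negative) measure $\mu$ on $S^{n-1}$ and a constant $C\in\mathbb{R}$ such that for every $x\in\mathbb{R}^n$, $\ln\|x\|_K=\int_{S^{n-1}}\ln|(x,\xi)|\,d\mu(\xi)+C$. For $0<p<n$, the space embeds in $L_{-p}$ if there exists a finite symmetric (non-negative) Borel measure $\mu$ on $S^{n-1}$ such that for every Schwartz test function $\phi$ on $\mathbb{R}^n$, $\int_{\mathbb{R}^n}\|x\|_K^{-p}\phi(x)\,dx=\int_{S^{n-1}}d\mu(\xi)\int_{\mathbb{R}}|t|^{p-1}\hat\phi(t\xi)\,dt$, where $\hat\phi(\xi)=\int_{\mathbb{R}^n}\phi(x)e^{-i(x,\xi)}dx$. *)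

theory Defs
  imports "HOL-Analysis.Analysis"
begin

definition minkowski_functional :: "(real^'n) set \<Rightarrow> real^'n \<Rightarrow> real" where
  "minkowski_functional K x = (LEAST a::real. 0 \<le> a \<and> x \<in> (\<lambda>y. a *\<^sub>R y) ` K)"

definition symmetric_star_body :: "(real^'n) set \<Rightarrow> bool" where
  "symmetric_star_body K \<longleftrightarrow>
     compact K \<and>
     uminus ` K = K \<and>
     (\<forall>u. u \<noteq> 0 \<longrightarrow> card (frontier K \<inter> range (\<lambda>t::real. t *\<^sub>R u)) = 2) \<and>
     continuous_on (sphere 0 1) (\<lambda>x. inverse (minkowski_functional K x)) \<and>
     0 \<in> interior K"

definition finite_sphere_measure :: "(real^'n) measure \<Rightarrow> bool" where
  "finite_sphere_measure \<mu> \<longleftrightarrow>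
     finite_measure \<mu> \<and> sets \<mu> = sets (restrict_space borel (sphere 0 1))"

(* The logarithm on [0, \<infinity>) with ln 0 = -\<infinity>; the library's ln on real has ln 0 = 0, which would
   make the defining identity of embedding in L_0 wrong when \<mu> charges a hyperplane. *)
definition ext_ln :: "real \<Rightarrow> ereal" where
  "ext_ln t = (if t = 0 then -\<infinity> else ereal (ln t))"

(* Lebesgue integral of an extended-real-valued function: integral of the positive part minus
   integral of the negative part (e2ennreal truncates negative values to 0).  It is only applied
   to functions that are bounded above on a finite measure space, so \<infinity> - \<infinity> does not arise. *)
definition ext_integral :: "'a measure \<Rightarrow> ('a \<Rightarrow> ereal) \<Rightarrow> ereal" where
  "ext_integral M f =
     enn2ereal (\<integral>\<^sup>+ x. e2ennreal (f x) \<partial>M) - enn2ereal (\<integral>\<^sup>+ x. e2ennreal (- f x) \<partial>M)"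

definition embeds_in_L0 :: "(real^'n) set \<Rightarrow> bool" where
  "embeds_in_L0 K \<longleftrightarrow>
     (\<exists>(\<mu>::(real^'n) measure) (C::real). finite_sphere_measure \<mu> \<and>
        (\<forall>x. ext_ln (minkowski_functional K x) =
             ext_integral \<mu> (\<lambda>\<xi>. ext_ln \<bar>x \<bullet> \<xi>\<bar>) + ereal C))"

definition partial_derivative :: "'n \<Rightarrow> (real^'n \<Rightarrow> complex) \<Rightarrow> real^'n \<Rightarrow> complex" where
  "partial_derivative i f x = frechet_derivative f (at x) (axis i 1)"

(* A multi-index is encoded as the list of the coordinate directions to differentiate in.
   Frechet differentiability of all iterated partial derivatives amounts to smoothness. *)
definition schwartz_function :: "(real^'n \<Rightarrow> complex) \<Rightarrow> bool" where
  "schwartz_function \<phi> \<longleftrightarrow>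
     (\<forall>is::'n list.
        (\<forall>x. foldr partial_derivative is \<phi> differentiable (at x)) \<and>
        (\<forall>k::nat. bounded (range (\<lambda>x. norm x ^ k *\<^sub>R foldr partial_derivative is \<phi> x))))"

definition fourier_transform :: "(real^'n \<Rightarrow> complex) \<Rightarrow> real^'n \<Rightarrow> complex" where
  "fourier_transform \<phi> \<xi> =
     (LINT x|lborel. \<phi> x * exp (- \<i> * complex_of_real (x \<bullet> \<xi>)))"

(* embeds_in_L_neg K p is embedding in L_{-p}; it is meant for 0 < p < n.  In that range all
   integrals below converge absolutely, and the values assigned by powr at the base 0 only
   affect null sets. *)
definition embeds_in_L_neg :: "(real^'n) set \<Rightarrow> real \<Rightarrow> bool" where
  "embeds_in_L_neg K p \<longleftrightarrow>
     (\<exists>\<mu>::(real^'n) measure. finite_sphere_measure \<mu> \<and>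
        (\<forall>A\<in>sets \<mu>. emeasure \<mu> (uminus ` A) = emeasure \<mu> A) \<and>
        (\<forall>\<phi>. schwartz_function \<phi> \<longrightarrow>
           (LINT x|lborel. (minkowski_functional K x powr (-p)) *\<^sub>R \<phi> x) =
           (LINT \<xi>|\<mu>. (LINT t|lborel. (\<bar>t\<bar> powr (p - 1)) *\<^sub>R fourier_transform \<phi> (t *\<^sub>R \<xi>)))))"

end

theory Submission
  imports Defs "HOL-Probability.Probability"
begin

text \<open>Write \<open>N\<close> for the Minkowski functional and let \<open>Z\<close> be a standard Gaussian vector. The Fourier
  identity for \<open>N\<^sup>-\<^sup>p\<close>, applied to the Gaussian test function \<open>exp (-|W\<^sup>-\<^sup>1 y|\<^sup>2/2)\<close>, says that
  \<open>E N(W Z)\<^sup>-\<^sup>p\<close> is a constant times the integral of \<open>|W* \<xi>|\<^sup>-\<^sup>p\<close>, for every invertible \<open>W\<close> with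
  adjoint \<open>W*\<close>. The case \<open>W = 1\<close> shows that the suitably normalised measures have mass tending to 1
  as \<open>p\<close> tends to 0; let \<open>\<nu>\<close> be a weak limit. Subtracting the case \<open>W = 1\<close>, dividing by \<open>p\<close> and letting
  \<open>p\<close> tend to 0 gives \<open>E ln N(W Z) - E ln N(Z) = \<integral> ln |W* \<xi>| d\<nu>\<close>. Now let \<open>W\<close> degenerate to the rank one
  map sending \<open>z\<close> to \<open>(z, e) x\<close>, so that \<open>|W* \<xi>|\<close> decreases to \<open>|(x, \<xi>)|\<close>: dominated convergence on the
  left and monotone convergence on the right yield
  \<open>ln N(x) = \<integral> ln |(x, \<xi>)| d\<nu> + E ln N(Z) - E ln |(Z, e)|\<close>.\<close>

section \<open>Weak compactness of probability measures on a compact set\<close>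

text \<open>The obstacle is that ln |(x, \<xi>)| is unbounded on the sphere, so weak convergence
  cannot be tested on it. For invertible \<open>W\<close> the function ln |\<open>W'\<close> \<xi>|
  is continuous on the compact sphere; hence \<open>W\<close> may become singular only after the
  limit p -> 0. Gaussians suit both sides of the hypothesis: a linear change of variables makes the
  left side a Gaussian expectation, and since the transform is again Gaussian, the integral over t
  is |\<open>W'\<close> \<xi>|^(-p) times the absolute moment \<open>\<kappa>\<close>, which does
  not depend on \<open>W\<close>. That moment grows like 2/p, so the given measures lose their mass
  as p -> 0 and have to be rescaled. Dividing by the total mass gives probability measures and makes
  the value of \<open>\<kappa>\<close> irrelevant: the factor E N(Z)^(-p), which tends to 1, takes
  its place. The degeneration has rank one because N((Z, e) x) = |(Z, e)| N(x), so that the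
  logarithm separates x from Z.\<close>

text \<open>A continuous function of period 2 that is 0 on [0, 1/3] and 1 on [2/3, 1]. Schoenberg's
  original is piecewise linear; the truncated cosine has continuity and periodicity built
  in.\<close>

definition schoenberg :: "real \<Rightarrow> real" where
  "schoenberg t = max 0 (min 1 (1/2 - cos (pi * t)))"

lemma continuous_on_schoenberg [continuous_intros]:
  fixes f :: "'a::t2_space \<Rightarrow> real"
  shows "continuous_on A f \<Longrightarrow> continuous_on A (\<lambda>x. schoenberg (f x))"
  unfolding schoenberg_def by (intro continuous_intros continuous_on_cos)

lemma schoenberg_bounds: "0 \<le> schoenberg t" "schoenberg t \<le> 1"
  by (auto simp: schoenberg_def)

text \<open>Periodicity removes the even integer, and the digit decides whether the rest lies in
  [0, 1/3] or in [2/3, 1].\<close>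

lemma schoenberg_digit:
  assumes c: "c \<in> {0, 1::real}" and r: "0 \<le> r" "r \<le> 1/3"
  shows "schoenberg (2 * of_int m + 2/3 * c + r) = c"
proof -
  have "cos (pi * (2 * of_int m + 2/3 * c + r)) = cos (pi * (2/3 * c + r) + 2 * pi * of_int m)"
    by (simp add: algebra_simps)
  also have "\<dots> = cos (pi * (2/3 * c + r))"
    by (simp only: cos_add cos_int_2pin sin_int_2pin mult_1_right mult_zero_right diff_zero)
  finally have eq: "cos (pi * (2 * of_int m + 2/3 * c + r)) = cos (pi * (2/3 * c + r))" .
  from c consider "c = 0" | "c = 1" by auto
  then show ?thesis
  proof cases
    case 1
    have "cos (pi / 3) \<le> cos (pi * r)"
      using r mult_left_mono[OF r(2), of pi] by (intro cos_monotone_0_pi_le) auto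
    then show ?thesis using eq 1 by (simp add: schoenberg_def cos_60)
  next
    case 2
    have "cos (pi * (2/3 + r)) \<le> cos (2 * pi / 3)"
      using r mult_left_mono[of "2/3 + r" 1 pi] by (intro cos_monotone_0_pi_le) auto
    then show ?thesis using eq 2 by (simp add: schoenberg_def cos_120)
  qed
qed

lemma ternary_sums:
  fixes c :: "nat \<Rightarrow> real"
  assumes "\<And>j. c j \<in> {0, 1}"
  shows "summable (\<lambda>j. 2 * c j / 3 ^ Suc j)"
    and "(\<Sum>j. 2 * c j / 3 ^ Suc j) \<in> {0..1}"
proof -
  have c: "0 \<le> c j" "c j \<le> 1" for j using assms[of j] by auto
  have s: "(\<lambda>j. 2/3 * (1/3) ^ j :: real) sums (2/3 * (1 / (1 - 1/3)))"
    by (intro sums_mult geometric_sums) auto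
  have le: "2 * c j / 3 ^ Suc j \<le> 2/3 * (1/3) ^ j" for j
    using c[of j] by (simp add: field_simps)
  have nn: "0 \<le> 2 * c j / 3 ^ Suc j" for j using c[of j] by simp
  show *: "summable (\<lambda>j. 2 * c j / 3 ^ Suc j)"
  proof (rule summable_comparison_test'[OF sums_summable[OF s]])
    show "norm (2 * c j / 3 ^ Suc j) \<le> 2/3 * (1/3) ^ j" for j
      using nn[of j] le[of j] by (simp only: real_norm_def abs_of_nonneg)
  qed
  show "(\<Sum>j. 2 * c j / 3 ^ Suc j) \<in> {0..1}"
    using suminf_le[OF le * sums_summable[OF s]] sums_unique[OF s] suminf_nonneg[OF * nn] by auto
qed

text \<open>Multiplication by 3^m moves the ternary point. As all digits are 0 or 2, the integer
  part is even and is removed by the period 2; the next digit contributes 0 or 2/3, and the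
  remaining ones at most 1/3.\<close>

lemma schoenberg_ternary:
  fixes c :: "nat \<Rightarrow> real"
  assumes c: "\<And>j. c j \<in> {0, 1}"
  shows "schoenberg (3 ^ m * (\<Sum>j. 2 * c j / 3 ^ Suc j)) = c m"
proof -
  let ?g = "\<lambda>j. 2 * c j / 3 ^ Suc j"
  have int: "\<exists>M::int. 3 ^ m * (\<Sum>j<m. ?g j) = 2 * of_int M" for m
  proof (induction m)
    case (Suc m)
    then obtain M :: int where M: "3 ^ m * (\<Sum>j<m. ?g j) = 2 * of_int M" by blast
    obtain d :: int where d: "c m = of_int d" using c[of m] by (metis insertE of_int_0 of_int_1 singletonD)
    have "3 ^ Suc m * (\<Sum>j<Suc m. ?g j) = 3 * (3 ^ m * (\<Sum>j<m. ?g j)) + 2 * c m"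
      by (simp add: algebra_simps)
    also have "\<dots> = 2 * of_int (3 * M + d)" using M d by simp
    finally show ?case by blast
  qed (auto intro: exI[of _ 0])
  then obtain M :: int where M: "3 ^ m * (\<Sum>j<m. ?g j) = 2 * of_int M" by blast
  \<comment> \<open>The tail beyond digit \<open>m\<close>: again a ternary number in [0, 1],
    shifted by one more place.\<close>
  define r where "r = (\<Sum>j. 2 * c (j + Suc m) / 3 ^ Suc j) / 3"
  have r: "0 \<le> r" "r \<le> 1/3"
    using ternary_sums(2)[of "\<lambda>j. c (j + Suc m)"] c by (auto simp: r_def)
  have "(\<Sum>j. ?g j) = (\<Sum>j. ?g (j + Suc m)) + (\<Sum>j<Suc m. ?g j)"
    by (intro suminf_split_initial_segment ternary_sums c)
  also have "(\<Sum>j. ?g (j + Suc m)) = (\<Sum>j. (1 / 3 ^ Suc m) * (2 * c (j + Suc m) / 3 ^ Suc j))"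
    by (intro suminf_cong) (simp add: power_add)
  also have "\<dots> = (1 / 3 ^ Suc m) * (3 * r)"
    unfolding r_def by (subst suminf_mult[OF ternary_sums(1)]) (use c in auto)
  finally have "3 ^ m * (\<Sum>j. ?g j) = r + 3 ^ m * (\<Sum>j<m. ?g j) + 2/3 * c m"
    by (simp add: field_simps)
  then have "3 ^ m * (\<Sum>j. ?g j) = 2 * of_int M + 2/3 * c m + r" using M by simp
  then show ?thesis using schoenberg_digit[OF c r, of M m] by simp
qed

text \<open>The digits are the increments of the dyadic truncations \<open>F\<close>, so the series
  telescopes; a < 1 makes the truncation at k = 0 vanish.\<close>

lemma binary_expansion:
  fixes a :: real
  assumes "0 \<le> a" "a < 1"
  obtains d :: "nat \<Rightarrow> real" where "\<And>k. d k \<in> {0, 1}" "(\<lambda>k. d k / 2 ^ Suc k) sums a"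
proof
  define F where "F k = of_int \<lfloor>2 ^ k * a\<rfloor> / (2 ^ k :: real)" for k :: nat
  define d where "d k = real_of_int (\<lfloor>2 ^ Suc k * a\<rfloor> - 2 * \<lfloor>2 ^ k * a\<rfloor>)" for k :: nat
  show "d k \<in> {0, 1}" for k
  proof -
    have "\<lfloor>2 * (2 ^ k * a)\<rfloor> - 2 * \<lfloor>2 ^ k * a\<rfloor> \<in> {0, 1}"
      by (simp; linarith)
    then show ?thesis unfolding d_def by (auto simp: mult.assoc)
  qed
  have "(\<lambda>k. a - (1/2) ^ k) \<longlonglongrightarrow> a - 0"
    by (intro tendsto_intros LIMSEQ_realpow_zero) auto
  moreover have "a - (1/2) ^ k \<le> F k" "F k \<le> a" for k
  proof -
    have "2 ^ k * a - 1 \<le> of_int \<lfloor>2 ^ k * a\<rfloor>" "of_int \<lfloor>2 ^ k * a\<rfloor> \<le> 2 ^ k * a" by linarith+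
    then have "(2 ^ k * a - 1) / 2 ^ k \<le> F k" "F k \<le> (2 ^ k * a) / 2 ^ k"
      unfolding F_def by (intro divide_right_mono; simp)+
    then show "a - (1/2) ^ k \<le> F k" "F k \<le> a" by (auto simp: diff_divide_distrib power_one_over)
  qed
  ultimately have "F \<longlonglongrightarrow> a"
    by (intro tendsto_sandwich[of "\<lambda>k. a - (1/2) ^ k" F _ "\<lambda>_. a"]) auto
  from telescope_sums[OF this] have "(\<lambda>k. F (Suc k) - F k) sums (a - F 0)" .
  moreover have "F 0 = 0" using assms by (simp add: F_def floor_eq_iff)
  moreover have "F (Suc k) - F k = d k / 2 ^ Suc k" for k
    by (simp add: F_def d_def field_simps)
  ultimately show "(\<lambda>k. d k / 2 ^ Suc k) sums a" by simp
qed

text \<open>If all ternary digits of \<open>t\<close> are 0 or 2, this is the number whose k-th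
  binary digit is half the ternary digit of \<open>t\<close> at position
  \<open>\<iota> k\<close>.\<close>

definition schoenberg_series :: "(nat \<Rightarrow> nat) \<Rightarrow> real \<Rightarrow> real" where
  "schoenberg_series \<iota> t = (\<Sum>k. schoenberg (3 ^ \<iota> k * t) / 2 ^ Suc k)"

lemma continuous_on_schoenberg_series: "continuous_on UNIV (schoenberg_series \<iota>)"
proof -
  have "uniform_limit UNIV (\<lambda>n t. \<Sum>k<n. schoenberg (3 ^ \<iota> k * t) / 2 ^ Suc k)
      (schoenberg_series \<iota>) sequentially"
    unfolding schoenberg_series_def
  proof (rule Weierstrass_m_test)
    show "summable (\<lambda>k. (1/2::real) * (1/2) ^ k)" by (intro summable_mult summable_geometric) auto
    show "norm (schoenberg (3 ^ \<iota> k * t) / 2 ^ Suc k) \<le> (1/2::real) * (1/2) ^ k" for k t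
      using schoenberg_bounds[of "3 ^ \<iota> k * t"] by (simp add: field_simps)
  qed
  then show ?thesis
    by (rule uniform_limit_theorem[rotated]) (auto intro!: always_eventually continuous_intros)
qed

text \<open>Schoenberg's space-filling curve: the ternary digits of the parameter are the binary digits
  of all the coordinates.\<close>

lemma space_filling_curve:
  fixes S :: "'a::euclidean_space set"
  assumes "bounded S"
  obtains q :: "real \<Rightarrow> 'a" where "continuous_on UNIV q" "S \<subseteq> q ` {0..1}"
proof -
  obtain R where R: "R > 0" "\<And>x. x \<in> S \<Longrightarrow> norm x \<le> R"
    using assms unfolding bounded_pos by blast
  define h :: "'a \<Rightarrow> nat" where "h = to_nat_on Basis"
  have inj: "inj_on h Basis" unfolding h_def by (intro inj_on_to_nat_on countable_finite) simp
  define \<iota> where "\<iota> b k = prod_encode (h b, k)" for b :: 'a and k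
  \<comment> \<open>Scaling by 2R + 1 instead of 2R keeps the normalised coordinates strictly below
    1, as \<open>binary_expansion\<close> requires.\<close>
  define q :: "real \<Rightarrow> 'a"
    where "q t = (\<Sum>b\<in>Basis. ((2 * R + 1) * schoenberg_series (\<iota> b) t - R) *\<^sub>R b)" for t
  have "continuous_on UNIV q" unfolding q_def
    by (intro continuous_intros continuous_on_schoenberg_series)
  moreover have "S \<subseteq> q ` {0..1}"
  proof
    fix x assume "x \<in> S"
    have "\<exists>d::nat \<Rightarrow> real. (\<forall>k. d k \<in> {0, 1}) \<and> (\<lambda>k. d k / 2 ^ Suc k) sums ((x \<bullet> b + R) / (2 * R + 1))"
      if b: "b \<in> Basis" for b
    proof -
      have "\<bar>x \<bullet> b\<bar> \<le> R" using R(2)[OF \<open>x \<in> S\<close>] Basis_le_norm[OF b, of x] by linarith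
      then have "0 \<le> (x \<bullet> b + R) / (2 * R + 1)" "(x \<bullet> b + R) / (2 * R + 1) < 1"
        using R(1) by (auto simp: field_simps)
      then show ?thesis using binary_expansion by metis
    qed
    then obtain d :: "'a \<Rightarrow> nat \<Rightarrow> real" where d: "\<And>b k. b \<in> Basis \<Longrightarrow> d b k \<in> {0, 1}"
      "\<And>b. b \<in> Basis \<Longrightarrow> (\<lambda>k. d b k / 2 ^ Suc k) sums ((x \<bullet> b + R) / (2 * R + 1))"
      by metis
    \<comment> \<open>A position encodes a pair of a coordinate and a digit index, so different
      coordinates never compete for a digit; positions that belong to no coordinate get 0.\<close>
    define c where "c j = (case prod_decode j of (i, k) \<Rightarrow>
      if i \<in> h ` Basis then d (inv_into Basis h i) k else 0)" for j
    have c: "c j \<in> {0, 1}" for j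
      using d(1) unfolding c_def by (auto split: prod.splits simp: inv_into_into)
    have cd: "c (\<iota> b k) = d b k" if "b \<in> Basis" for b k
      using that inj by (simp add: c_def \<iota>_def inv_into_f_f)
    define t where "t = (\<Sum>j. 2 * c j / 3 ^ Suc j)"
    have "schoenberg_series (\<iota> b) t = (x \<bullet> b + R) / (2 * R + 1)" if b: "b \<in> Basis" for b
      unfolding schoenberg_series_def t_def schoenberg_ternary[OF c] cd[OF b]
      using sums_unique[OF d(2)[OF b]] by simp
    then have "q t = (\<Sum>b\<in>Basis. (x \<bullet> b) *\<^sub>R b)"
      using R(1) unfolding q_def by (intro sum.cong) auto
    then have "q t = x" by (simp add: euclidean_representation)
    moreover have "t \<in> {0..1}" unfolding t_def by (intro ternary_sums c)
    ultimately show "x \<in> q ` {0..1}" by blast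
  qed
  ultimately show thesis by (rule that)
qed

section \<open>Transport of measures between a compact set and the unit interval\<close>

text \<open>The curve is not injective, so a preimage has to be selected measurably. The leftmost
  one is Borel because its sublevel sets are \<open>S\<close> intersected with the images of compact
  intervals.\<close>

lemma leftmost_preimage_borel:
  fixes q :: "real \<Rightarrow> 'a::{t2_space, second_countable_topology}"
  assumes q: "continuous_on UNIV q" and S: "S \<subseteq> q ` {0..1}"
  obtains e where "e \<in> borel_measurable (restrict_space borel S)"
    "\<And>x. x \<in> S \<Longrightarrow> q (e x) = x" "\<And>x. x \<in> S \<Longrightarrow> e x \<in> {0..1}"
proof -
  have "\<exists>t. t \<in> {0..1} \<and> q t = x \<and> (\<forall>s\<in>{0..1}. q s = x \<longrightarrow> t \<le> s)" if "x \<in> S" for x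
  proof -
    have "closed (q -` {x})" by (intro closed_vimage q) simp
    then have "compact ({0..1} \<inter> q -` {x})" by (intro compact_Int_closed) simp_all
    moreover have "{0..1} \<inter> q -` {x} \<noteq> {}" using S that by force
    ultimately obtain t where "t \<in> {0..1} \<inter> q -` {x}" "\<forall>s\<in>{0..1} \<inter> q -` {x}. t \<le> s"
      using compact_attains_inf by blast
    then show ?thesis by auto
  qed
  then obtain e where e: "\<And>x. x \<in> S \<Longrightarrow> e x \<in> {0..1}" "\<And>x. x \<in> S \<Longrightarrow> q (e x) = x"
    "\<And>x s. x \<in> S \<Longrightarrow> s \<in> {0..1} \<Longrightarrow> q s = x \<Longrightarrow> e x \<le> s"
    by metis
  have "e \<in> borel_measurable (restrict_space borel S)"
    unfolding borel_measurable_iff_le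
  proof
    fix a :: real
    have "{x \<in> space (restrict_space borel S). e x \<le> a} = q ` {0..min a 1} \<inter> S"
      using e by (force simp: space_restrict_space)
    moreover have "q ` {0..min a 1} \<in> sets borel"
      by (intro borel_closed compact_imp_closed compact_continuous_image continuous_on_subset[OF q]) auto
    ultimately show "{x \<in> space (restrict_space borel S). e x \<le> a} \<in> sets (restrict_space borel S)"
      by (auto simp: sets_restrict_space)
  qed
  with e(1,2) that show thesis by blast
qed

text \<open>Pulling the measures back to \<open>[0, 1]\<close> along a Borel section of a space-filling curve reduces this
  to the one-dimensional Helly selection theorem.\<close>

theorem compact_prob_space_convergent_subsequence:
  fixes S :: "'a::euclidean_space set" and P :: "nat \<Rightarrow> 'a measure"
  assumes S: "compact S"
    and P: "\<And>k. prob_space (P k)" "\<And>k. sets (P k) = sets (restrict_space borel S)"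
  obtains r :: "nat \<Rightarrow> nat" and \<nu> :: "'a measure"
  where "strict_mono r" "prob_space \<nu>" "sets \<nu> = sets (restrict_space borel S)"
    "\<And>f::'a \<Rightarrow> real. continuous_on S f \<Longrightarrow> (\<lambda>k. \<integral>x. f x \<partial>P (r k)) \<longlonglongrightarrow> (\<integral>x. f x \<partial>\<nu>)"
proof -
  have space_P: "space (P k) = S" for k
    using sets_eq_imp_space_eq[OF P(2)] by (simp add: space_restrict_space)
  have "S \<noteq> {}" using prob_space.not_empty[OF P(1)] space_P by simp
  then obtain s0 where s0: "s0 \<in> S" by blast
  obtain q :: "real \<Rightarrow> 'a" where q: "continuous_on UNIV q" "S \<subseteq> q ` {0..1}"
    using space_filling_curve[OF compact_imp_bounded[OF S]] .
  obtain e where e: "e \<in> borel_measurable (restrict_space borel S)"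
    "\<And>x. x \<in> S \<Longrightarrow> q (e x) = x" "\<And>x. x \<in> S \<Longrightarrow> e x \<in> {0..1}"
    using leftmost_preimage_borel[OF q] by metis
  have eP [measurable]: "e \<in> borel_measurable (P k)" for k
    using e(1) measurable_cong_sets[OF P(2) refl] by blast
  have qb [measurable]: "q \<in> borel_measurable borel" by (intro borel_measurable_continuous_onI q)
  define \<Lambda> where "\<Lambda> k = distr (P k) borel e" for k
  have rd: "real_distribution (\<Lambda> k)" for k
    unfolding \<Lambda>_def by (intro prob_space.real_distribution_distr P eP)
  \<comment> \<open>The left end is -1 and not 0 because tightness is stated with half-open
    intervals and \<open>e\<close> may take the value 0.\<close>
  have "measure (\<Lambda> k) {-1<..1} = 1" for k
  proof -
    have "measure (\<Lambda> k) {-1<..1} = measure (P k) (e -` {-1<..1} \<inter> space (P k))"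
      unfolding \<Lambda>_def by (intro measure_distr eP) auto
    also have "e -` {-1<..1} \<inter> space (P k) = space (P k)"
      using e(3) space_P by force
    finally show ?thesis using prob_space.prob_space[OF P(1)] by simp
  qed
  then have "tight \<Lambda>"
    unfolding tight_def using rd by (intro conjI allI impI exI[of _ "-1"] exI[of _ 1]) auto
  from tight_imp_convergent_subsubsequence[OF this strict_mono_id]
  obtain r L where r: "strict_mono r" "real_distribution L" "weak_conv_m (\<Lambda> \<circ> id \<circ> r) L"
    by blast
  interpret L: real_distribution L by fact
  have weak: "weak_conv_m (\<lambda>k. \<Lambda> (r k)) L" using r(3) by (simp add: comp_def)
  have conv: "(\<lambda>k. \<integral>x. f (q (e x)) \<partial>P (r k)) \<longlonglongrightarrow> (\<integral>t. f (q t) \<partial>L)"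
    if f: "continuous_on UNIV f" "bounded (range f)" for f :: "'a \<Rightarrow> real"
  proof -
    obtain B where B: "\<And>x. norm (f x) \<le> B" using f(2) unfolding bounded_iff by auto
    have fq: "continuous_on UNIV (\<lambda>t. f (q t))"
      using continuous_on_compose2[OF f(1) q(1)] by simp
    have "(\<lambda>k. integral\<^sup>L (\<Lambda> (r k)) (\<lambda>t. f (q t))) \<longlonglongrightarrow> integral\<^sup>L L (\<lambda>t. f (q t))"
    proof (rule weak_conv_imp_integral_bdd_continuous_conv)
      show "real_distribution (\<Lambda> (r k))" for k by (rule rd)
      show "isCont (\<lambda>t. f (q t)) t" for t
        using fq by (simp add: continuous_on_eq_continuous_at)
    qed (fact r(2) weak B)+
    moreover have "integral\<^sup>L (\<Lambda> (r k)) (\<lambda>t. f (q t)) = (\<integral>x. f (q (e x)) \<partial>P (r k))" for k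
      unfolding \<Lambda>_def
      by (intro integral_distr eP borel_measurable_continuous_onI fq)
    ultimately show ?thesis by simp
  qed
  \<comment> \<open>The limit \<open>L\<close> is carried by the preimage of \<open>S\<close>: the
    truncated distance to \<open>S\<close> vanishes along the section, so its
    \<open>L\<close>-integral is a limit of zeros.\<close>
  have AE: "AE t in L. q t \<in> S"
  proof -
    let ?f = "\<lambda>x. min 1 (infdist x S)"
    have c: "continuous_on UNIV ?f" by (intro continuous_intros)
    have nn: "0 \<le> ?f x" "?f x \<le> 1" for x by (auto simp: infdist_nonneg)
    have "bounded (range ?f)" by (rule boundedI[of _ 1]) (use nn in \<open>auto simp: infdist_nonneg\<close>)
    from conv[OF c this] have "(\<lambda>k. \<integral>x. ?f (q (e x)) \<partial>P (r k)) \<longlonglongrightarrow> (\<integral>t. ?f (q t) \<partial>L)" .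
    moreover have "(\<integral>x. ?f (q (e x)) \<partial>P (r k)) = (\<integral>x. 0 \<partial>P (r k))" for k
      by (intro Bochner_Integration.integral_cong) (auto simp: space_P e)
    ultimately have "(\<integral>t. ?f (q t) \<partial>L) = 0"
      by (simp add: LIMSEQ_const_iff)
    moreover have meas: "(\<lambda>t. ?f (q t)) \<in> borel_measurable L"
      using borel_measurable_continuous_onI[OF continuous_on_compose2[OF c q(1)]] by simp
    moreover have "integrable L (\<lambda>t. ?f (q t))"
      by (rule L.integrable_const_bound[of _ 1]) (use nn meas in \<open>auto simp: infdist_nonneg\<close>)
    ultimately have "AE t in L. ?f (q t) = 0"
      using integral_nonneg_eq_0_iff_AE[of L "\<lambda>t. ?f (q t)"] nn by auto
    then show ?thesis
    proof (eventually_elim)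
      case (elim t)
      then have "infdist (q t) S = 0" by (simp add: min_def split: if_splits)
      then show ?case using in_closed_iff_infdist_zero[OF compact_imp_closed[OF S] \<open>S \<noteq> {}\<close>] by simp
    qed
  qed
  \<comment> \<open>The curve leaves \<open>S\<close> only on an \<open>L\<close>-null set; the
    arbitrary value \<open>s0\<close> there makes \<open>g\<close> a map into \<open>S\<close>
    everywhere, so that \<open>L\<close> can be pushed forward to \<open>S\<close>.\<close>
  define g where "g t = (if q t \<in> S then q t else s0)" for t
  have Sb [measurable]: "S \<in> sets borel" using S by (intro borel_closed compact_imp_closed)
  have gS: "g t \<in> S" for t using s0 by (simp add: g_def)
  have "g \<in> borel_measurable L" unfolding g_def by measurable
  then have g [measurable]: "g \<in> measurable L (restrict_space borel S)"
    using gS by (intro measurable_restrict_space2) auto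
  define \<nu> where "\<nu> = distr L (restrict_space borel S) g"
  show thesis
  proof (rule that[of r \<nu>])
    show "prob_space \<nu>" unfolding \<nu>_def by (intro L.prob_space_distr g)
    show "sets \<nu> = sets (restrict_space borel S)" by (simp add: \<nu>_def)
    fix f :: "'a \<Rightarrow> real" assume f: "continuous_on S f"
    have "bounded (f ` S)" by (intro compact_imp_bounded compact_continuous_image f S)
    then obtain B where B: "0 \<le> B" "\<And>x. x \<in> S \<Longrightarrow> norm (f x) \<le> B"
      using bounded_pos by (metis imageI less_imp_le)
    \<comment> \<open>\<open>conv\<close> needs a bounded continuous function on the whole space,
      because \<open>q\<close> need not stay in \<open>S\<close>; Tietze extends \<open>f\<close>
      with the same bound.\<close>
    obtain F where F: "continuous_on UNIV F" "\<And>x. x \<in> S \<Longrightarrow> F x = f x" "\<And>x. norm (F x) \<le> B"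
      using Tietze[of S f UNIV B] f B compact_imp_closed[OF S] by auto
    have "(\<lambda>k. \<integral>x. F (q (e x)) \<partial>P (r k)) \<longlonglongrightarrow> (\<integral>t. F (q t) \<partial>L)"
      by (intro conv F(1)) (use F(3) in \<open>auto intro!: boundedI[of _ B]\<close>)
    moreover have "(\<integral>x. F (q (e x)) \<partial>P (r k)) = (\<integral>x. f x \<partial>P (r k))" for k
      by (intro Bochner_Integration.integral_cong) (auto simp: space_P e F)
    moreover have "(\<integral>t. F (q t) \<partial>L) = (\<integral>t. f (g t) \<partial>L)"
    proof (rule integral_cong_AE)
      show "(\<lambda>t. F (q t)) \<in> borel_measurable L"
        using borel_measurable_continuous_onI[OF continuous_on_compose2[OF F(1) q(1)]] by simp
      show "(\<lambda>t. f (g t)) \<in> borel_measurable L"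
        by (rule measurable_compose[OF g]) (rule borel_measurable_continuous_on_restrict[OF f])
      show "AE t in L. F (q t) = f (g t)" using AE by eventually_elim (simp add: g_def F)
    qed
    moreover have "(\<integral>t. f (g t) \<partial>L) = (\<integral>x. f x \<partial>\<nu>)"
      unfolding \<nu>_def by (intro integral_distr[symmetric] g borel_measurable_continuous_on_restrict f)
    ultimately show "(\<lambda>k. \<integral>x. f x \<partial>P (r k)) \<longlonglongrightarrow> (\<integral>x. f x \<partial>\<nu>)" by simp
  qed (fact r)
qed

section \<open>Gaussian integrals and linear maps\<close>

lemma lborel_integrable_prod:
  fixes f :: "'a::euclidean_space \<Rightarrow> real \<Rightarrow> 'b::{real_normed_field,banach,second_countable_topology}"
  assumes f: "\<And>b. b \<in> Basis \<Longrightarrow> integrable lborel (f b)"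
  shows "integrable lborel (\<lambda>x. \<Prod>b\<in>Basis. f b (x \<bullet> b))"
    and "(\<integral>x. (\<Prod>b\<in>Basis. f b (x \<bullet> b)) \<partial>lborel) = (\<Prod>b\<in>Basis. integral\<^sup>L lborel (f b))"
proof -
  interpret product_sigma_finite "\<lambda>b::'a. lborel :: real measure" by standard
  have T: "(\<lambda>x. \<Sum>b\<in>Basis. x b *\<^sub>R b) \<in> measurable (\<Pi>\<^sub>M b\<in>(Basis :: 'a set). lborel) borel"
    by measurable
  have m [measurable]: "f b \<in> borel_measurable borel" if "b \<in> Basis" for b
    using f[OF that] by (auto dest: borel_measurable_integrable)
  have F: "(\<lambda>x::'a. \<Prod>b\<in>Basis. f b (x \<bullet> b)) \<in> borel_measurable borel"
    by measurable
  have eq: "(\<Prod>b\<in>Basis. f b ((\<Sum>c\<in>Basis. x c *\<^sub>R c) \<bullet> b)) = (\<Prod>b\<in>Basis. f b (x b))" for x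
    by (intro prod.cong) (auto simp: inner_sum_left_Basis)
  show "integrable lborel (\<lambda>x. \<Prod>b\<in>Basis. f b (x \<bullet> b))"
    by (subst lborel_eq, subst integrable_distr_eq[OF T F]) (simp add: eq product_integrable_prod f)
  show "(\<integral>x. (\<Prod>b\<in>Basis. f b (x \<bullet> b)) \<partial>lborel) = (\<Prod>b\<in>Basis. integral\<^sup>L lborel (f b))"
    by (subst lborel_eq, subst integral_distr[OF T F]) (simp add: eq product_integral_prod f)
qed

lemma linear_borel_measurable:
  fixes W :: "'a::euclidean_space \<Rightarrow> 'b::euclidean_space"
  shows "linear W \<Longrightarrow> W \<in> borel_measurable borel"
  by (intro borel_measurable_continuous_onI linear_continuous_on) (simp add: linear_linear)

lemma nn_integral_lborel_translate:
  fixes f :: "'a::euclidean_space \<Rightarrow> ennreal"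
  assumes [measurable]: "f \<in> borel_measurable borel"
  shows "(\<integral>\<^sup>+x. f (c + x) \<partial>lborel) = (\<integral>\<^sup>+x. f x \<partial>lborel)"
proof -
  have "(\<integral>\<^sup>+x. f x \<partial>distr lborel borel ((+) c)) = (\<integral>\<^sup>+x. f (c + x) \<partial>lborel)"
    by (intro nn_integral_distr) auto
  then show ?thesis by (simp add: lborel_distr_plus)
qed

text \<open>The library computes the measure of a linear image only in \<open>real^'n\<close> with a well-ordered index
  type. The constant is of no importance here, so the uniqueness argument for translation-invariant
  measures is used instead.\<close>

lemma nn_integral_lborel_linear_mult:
  fixes W V :: "'a::euclidean_space \<Rightarrow> 'a"
  assumes W: "linear W" and WV: "\<And>x. W (V x) = x"
    and [measurable]: "f \<in> borel_measurable borel" "g \<in> borel_measurable borel"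
  shows "(\<integral>\<^sup>+z. f (W z) \<partial>lborel) * (\<integral>\<^sup>+y. g y \<partial>lborel)
    = (\<integral>\<^sup>+z. g (- W z) \<partial>lborel) * (\<integral>\<^sup>+y. f y \<partial>lborel)"
proof -
  have [measurable]: "W \<in> borel_measurable borel" using W by (rule linear_borel_measurable)
  have "(\<integral>\<^sup>+z. f (W z) \<partial>lborel) * (\<integral>\<^sup>+y. g y \<partial>lborel)
      = (\<integral>\<^sup>+z. f (W z) * (\<integral>\<^sup>+y. g (- W z + y) \<partial>lborel) \<partial>lborel)"
  proof -
    have "(\<integral>\<^sup>+y. g (- W z + y) \<partial>lborel) = (\<integral>\<^sup>+y. g y \<partial>lborel)" for z
      by (rule nn_integral_lborel_translate) measurable
    then show ?thesis by (simp only:) (rule nn_integral_multc[symmetric], measurable)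
  qed
  also have "\<dots> = (\<integral>\<^sup>+z. (\<integral>\<^sup>+y. f (W z) * g (- W z + y) \<partial>lborel) \<partial>lborel)"
    by (intro nn_integral_cong nn_integral_cmult[symmetric]) auto
  also have "\<dots> = (\<integral>\<^sup>+y. (\<integral>\<^sup>+z. f (W z) * g (- W z + y) \<partial>lborel) \<partial>lborel)"
    by (rule lborel_pair.Fubini'[symmetric]) measurable
  also have "\<dots> = (\<integral>\<^sup>+y. (\<integral>\<^sup>+z. f (W z + y) * g (- W z) \<partial>lborel) \<partial>lborel)"
  \<comment> \<open>So far translation invariance was used in \<open>y\<close>, with the shift
    \<open>- W z\<close>. The substitution of \<open>V y + z\<close> for \<open>z\<close> now turns
    \<open>W z\<close> into \<open>W z + y\<close> and so moves the translation from
    \<open>g\<close> to \<open>f\<close>.\<close>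
  proof (rule nn_integral_cong)
    fix y
    have "(\<integral>\<^sup>+z. f (W z) * g (- W z + y) \<partial>lborel)
        = (\<integral>\<^sup>+z. f (W (V y + z)) * g (- W (V y + z) + y) \<partial>lborel)"
      by (intro nn_integral_lborel_translate[symmetric]) measurable
    then show "(\<integral>\<^sup>+z. f (W z) * g (- W z + y) \<partial>lborel) = (\<integral>\<^sup>+z. f (W z + y) * g (- W z) \<partial>lborel)"
      by (simp add: linear_add[OF W] WV add.commute)
  qed
  also have "\<dots> = (\<integral>\<^sup>+z. (\<integral>\<^sup>+y. f (W z + y) * g (- W z) \<partial>lborel) \<partial>lborel)"
    by (rule lborel_pair.Fubini') measurable
  also have "\<dots> = (\<integral>\<^sup>+z. g (- W z) \<partial>lborel) * (\<integral>\<^sup>+y. f y \<partial>lborel)"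
  proof -
    have "(\<integral>\<^sup>+y. f (W z + y) * g (- W z) \<partial>lborel) = g (- W z) * (\<integral>\<^sup>+y. f y \<partial>lborel)" for z
      by (subst nn_integral_multc) (simp_all add: nn_integral_lborel_translate mult.commute)
    then show ?thesis by (simp add: nn_integral_multc)
  qed
  finally show ?thesis .
qed

text \<open>Apply \<open>nn_integral_lborel_linear_mult\<close> with the indicator of the unit ball
  as \<open>g\<close>; the ball is symmetric, so the minus sign disappears, and the image measure is
  a multiple of \<open>lborel\<close>. The constant b / a, the volume of the ball over that of its
  preimage, is the absolute determinant of \<open>W\<close>.\<close>

lemma lborel_distr_linear:
  fixes W V :: "'a::euclidean_space \<Rightarrow> 'a"
  assumes W: "linear W" and V: "linear V" and WV: "\<And>x. W (V x) = x" "\<And>x. V (W x) = x"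
  obtains c :: real where "c > 0" "lborel = density (distr lborel borel W) (\<lambda>_. ennreal c)"
proof -
  have [measurable]: "W \<in> borel_measurable borel" using W by (rule linear_borel_measurable)
  let ?A = "V ` ball 0 1"
  have A: "?A = W -` ball 0 1" using WV by (auto simp: image_iff intro!: bexI[of _ "W _"])
  have oA: "open ?A" unfolding A
    using W by (intro open_vimage linear_continuous_on) (auto simp: linear_linear)
  have "bounded ?A" using V by (intro bounded_linear_image) (auto simp: linear_linear)
  then have "emeasure lborel ?A < \<infinity>" by (rule emeasure_bounded_finite)
  moreover have "emeasure lborel ?A \<noteq> 0"
  proof -
    have "V 0 \<in> ?A" by simp
    then obtain e where e: "e > 0" "ball (V 0) e \<subseteq> ?A" using oA open_contains_ball by blast
    have "0 < measure lborel (ball (V 0) e)" using e by (simp add: content_ball_pos)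
    then have "0 < emeasure lborel (ball (V 0) e)"
      by (metis measure_def enn2real_0 less_irrefl zero_less_iff_neq_zero)
    also have "\<dots> \<le> emeasure lborel ?A" using e oA by (intro emeasure_mono) auto
    finally show ?thesis by simp
  qed
  ultimately obtain a where a: "a > 0" "emeasure lborel ?A = ennreal a"
    by (cases "emeasure lborel ?A") (auto simp: less_top[symmetric])
  have "0 < measure lborel (ball (0::'a) 1)" by (simp add: content_ball_pos)
  then obtain b where b: "b > 0" "emeasure lborel (ball (0::'a) 1) = ennreal b"
    using emeasure_lborel_ball_finite[of "0::'a" 1]
    by (intro that[OF _ emeasure_eq_ennreal_measure]) (auto simp: less_top[symmetric])
  have *: "emeasure (distr lborel borel W) B * ennreal b = ennreal a * emeasure lborel B"
    if [measurable]: "B \<in> sets borel" for B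
  proof -
    have [measurable]: "ball (0::'a) 1 \<in> sets borel" by simp
    have "(\<integral>\<^sup>+z. indicator B (W z) \<partial>lborel) * (\<integral>\<^sup>+y. indicator (ball (0::'a) 1) y \<partial>lborel)
      = (\<integral>\<^sup>+z. indicator (ball 0 1) (- W z) \<partial>lborel) * (\<integral>\<^sup>+y. indicator B y \<partial>lborel)"
      by (rule nn_integral_lborel_linear_mult[OF W WV(1)]) measurable
    moreover have "(\<integral>\<^sup>+z. indicator B (W z) \<partial>lborel) = emeasure (distr lborel borel W) B"
      by (subst nn_integral_distr[of W lborel borel "indicator B", symmetric]) auto
    moreover have "(\<integral>\<^sup>+z. indicator (ball 0 1) (- W z) \<partial>lborel) = (\<integral>\<^sup>+z. indicator ?A z \<partial>lborel)"
      unfolding A by (intro nn_integral_cong) (auto simp: indicator_def)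
    ultimately show ?thesis using a b oA by simp
  qed
  show thesis
  proof (rule that[of "b / a"])
    show "lborel = density (distr lborel borel W) (\<lambda>_. ennreal (b / a))"
    proof (rule measure_eqI)
      fix B :: "'a set" assume "B \<in> sets lborel"
      then have B: "B \<in> sets borel" by simp
      have "emeasure (density (distr lborel borel W) (\<lambda>_. ennreal (b / a))) B
          = ennreal (b / a) * emeasure (distr lborel borel W) B"
        using B by (subst emeasure_density_const) auto
      also have "\<dots> = ennreal (1 / a) * (emeasure (distr lborel borel W) B * ennreal b)"
        using a b by (simp add: divide_inverse ennreal_mult mult_ac)
      also have "\<dots> = (ennreal (1 / a) * ennreal a) * emeasure lborel B"
        unfolding *[OF B] by (simp add: mult_ac)
      also have "ennreal (1 / a) * ennreal a = 1"
        using a by (simp add: ennreal_mult[symmetric] del: ennreal_mult)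
      finally show "emeasure lborel B = emeasure (density (distr lborel borel W) (\<lambda>_. ennreal (b / a))) B"
        by simp
    qed simp
  qed (use a b in auto)
qed

lemma lborel_integral_linear:
  fixes W V :: "'a::euclidean_space \<Rightarrow> 'a"
  assumes W: "linear W" and V: "linear V" and WV: "\<And>x. W (V x) = x" "\<And>x. V (W x) = x"
  obtains c :: real where "c > 0"
    "\<And>f::'a \<Rightarrow> 'b::{banach,second_countable_topology}. f \<in> borel_measurable borel \<Longrightarrow>
      (\<integral>y. f y \<partial>lborel) = c *\<^sub>R (\<integral>z. f (W z) \<partial>lborel)"
proof -
  obtain c :: real where c: "c > 0" "lborel = density (distr lborel borel W) (\<lambda>_. ennreal c)"
    using lborel_distr_linear[OF assms] by blast
  have [measurable]: "W \<in> borel_measurable borel" using W by (rule linear_borel_measurable)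
  have "(\<integral>y. f y \<partial>lborel) = c *\<^sub>R (\<integral>z. f (W z) \<partial>lborel)"
    if [measurable]: "f \<in> borel_measurable borel" for f :: "'a \<Rightarrow> 'b"
  proof -
    have "(\<integral>y. f y \<partial>lborel) = (\<integral>y. f y \<partial>density (distr lborel borel W) (\<lambda>_. ennreal c))"
      using c(2) by simp
    also have "\<dots> = (\<integral>y. c *\<^sub>R f y \<partial>distr lborel borel W)"
      using c(1) by (subst integral_density) auto
    also have "\<dots> = c *\<^sub>R (\<integral>z. f (W z) \<partial>lborel)"
      by (simp add: integral_distr)
    finally show ?thesis .
  qed
  with c(1) that show thesis by blast
qed

section \<open>The standard Gaussian: integrability and Fourier transform\<close>

text \<open>The powers and logarithms of the gauge that occur later are singular near a hyperplane
  and are dominated there by the inverse square root of a coordinate.\<close>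

lemma integrable_inverse_sqrt_std_normal:
  "integrable lborel (\<lambda>t. inverse (sqrt \<bar>t\<bar>) * std_normal_density t)"
proof -
  \<comment> \<open>\<open>f\<close> carries the singularity on the right of 0 and its reflection
    the one on the left; outside [-1, 1] the density alone dominates.\<close>
  define f :: "real \<Rightarrow> real" where "f t = indicator {0..1} t * inverse (sqrt t)" for t
  have "((\<lambda>t. t powr (-1/2)) has_integral (1 powr (-1/2 + 1) / (-1/2 + 1))) {0..1::real}"
    by (rule has_integral_powr_from_0) auto
  then have "(\<lambda>t. t powr (-1/2)) absolutely_integrable_on {0..1::real}"
    by (intro nonnegative_absolutely_integrable_1) (auto simp: has_integral_integrable)
  then have "integrable lebesgue (\<lambda>t. indicator {0..1} t *\<^sub>R (t powr (-1/2)) :: real)"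
    by (simp add: set_integrable_def)
  also have "(\<lambda>t. indicator {0..1} t *\<^sub>R (t powr (-1/2)) :: real) = f"
    by (auto simp: f_def fun_eq_iff powr_minus powr_half_sqrt indicator_def)
  finally have fl: "integrable lebesgue f" .
  have fm: "f \<in> borel_measurable borel" unfolding f_def by measurable
  have f: "integrable lborel f"
    using fl fm by (subst (asm) integrable_completion) simp_all
  have f': "integrable lborel (\<lambda>t. f (- t))"
    using lborel_integrable_real_affine[OF f, of "-1" 0] by simp
  show ?thesis
  proof (rule Bochner_Integration.integrable_bound)
    show "integrable lborel (\<lambda>t. std_normal_density t + f t + f (- t))"
      by (intro Bochner_Integration.integrable_add f f' integrable_normal_density) simp
    show "AE t in lborel. norm (inverse (sqrt \<bar>t\<bar>) * std_normal_density t)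
        \<le> norm (std_normal_density t + f t + f (- t))"
    proof (intro AE_I2)
      fix t :: real
      have d: "0 \<le> std_normal_density t" "std_normal_density t \<le> 1"
      proof -
        have "std_normal_density t = 1 / sqrt (2 * pi) * exp (- t\<^sup>2 / 2)"
          by (simp add: std_normal_density_def)
        also have "\<dots> \<le> 1 * 1" using pi_gt3 by (intro mult_mono) auto
        finally show "std_normal_density t \<le> 1" by simp
      qed (simp add: normal_density_nonneg)
      have nn: "0 \<le> f t" "0 \<le> f (-t)" by (auto simp: f_def indicator_def)
      have "inverse (sqrt \<bar>t\<bar>) * std_normal_density t \<le> std_normal_density t + f t + f (- t)"
      proof (cases "\<bar>t\<bar> \<le> 1")
        case True
        then have "inverse (sqrt \<bar>t\<bar>) \<le> f t + f (- t)"
          by (cases "t < 0") (auto simp: f_def indicator_def)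
        moreover have "inverse (sqrt \<bar>t\<bar>) * std_normal_density t \<le> inverse (sqrt \<bar>t\<bar>) * 1"
          using d by (intro mult_left_mono) auto
        ultimately show ?thesis using d by linarith
      next
        case False
        then have "inverse (sqrt \<bar>t\<bar>) \<le> 1" by (simp add: field_simps)
        then have "inverse (sqrt \<bar>t\<bar>) * std_normal_density t \<le> 1 * std_normal_density t"
          using d by (intro mult_right_mono) auto
        then show ?thesis using nn by simp
      qed
      then show "norm (inverse (sqrt \<bar>t\<bar>) * std_normal_density t)
        \<le> norm (std_normal_density t + f t + f (- t))"
        using d nn by simp
    qed
  qed auto
qed

text \<open>The product form lets Fubini reduce moments and the Fourier transform to the
  one-dimensional normal density.\<close>

definition gauss_density :: "'a::euclidean_space \<Rightarrow> real" where
  "gauss_density x = (\<Prod>b\<in>Basis. std_normal_density (x \<bullet> b))"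

text \<open>The constant stays anonymous because it cancels in
  \<open>embedding_gaussian\<close>.\<close>

lemma gauss_density_eq:
  obtains C where "C > 0" "\<And>x::'a::euclidean_space. gauss_density x = C * exp (- (x \<bullet> x) / 2)"
proof
  show "(1 / sqrt (2 * pi)) ^ DIM('a) > 0" by simp
  fix x :: 'a
  have "gauss_density x = (\<Prod>b\<in>(Basis::'a set). 1 / sqrt (2 * pi)) * (\<Prod>b\<in>Basis. exp (- (x \<bullet> b)\<^sup>2 / 2))"
    unfolding gauss_density_def std_normal_density_def prod.distrib by simp
  also have "(\<Prod>b\<in>Basis. exp (- (x \<bullet> b)\<^sup>2 / 2)) = exp (\<Sum>b\<in>Basis. - (x \<bullet> b)\<^sup>2 / 2)"
    by (simp add: exp_sum)
  also have "(\<Sum>b\<in>Basis. - (x \<bullet> b)\<^sup>2 / 2) = - (x \<bullet> x) / 2"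
    unfolding euclidean_inner[of x x] by (simp add: power2_eq_square sum_negf sum_divide_distrib)
  finally show "gauss_density x = (1 / sqrt (2 * pi)) ^ DIM('a) * exp (- (x \<bullet> x) / 2)" by simp
qed

lemma gauss_density_nonneg: "0 \<le> gauss_density x"
  by (simp add: gauss_density_def prod_nonneg normal_density_nonneg)

lemma gauss_density_measurable [measurable]: "gauss_density \<in> borel_measurable borel"
  unfolding gauss_density_def by measurable

lemma gauss_density_integral:
  "integrable lborel (gauss_density :: 'a::euclidean_space \<Rightarrow> real)"
  "(\<integral>x. gauss_density (x::'a) \<partial>lborel) = 1"
  unfolding gauss_density_def
  using lborel_integrable_prod[of "\<lambda>b::'a. std_normal_density"] by auto

lemma gauss_density_integrable_coord:
  fixes b :: "'a::euclidean_space"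
  assumes b: "b \<in> Basis" and g: "integrable lborel (\<lambda>t. g t * std_normal_density t)"
  shows "integrable lborel (\<lambda>x::'a. g (x \<bullet> b) * gauss_density x)"
proof -
  have "integrable lborel (\<lambda>x::'a. \<Prod>c\<in>Basis.
      (if c = b then (\<lambda>t. g t * std_normal_density t) else std_normal_density) (x \<bullet> c))"
    using g by (intro lborel_integrable_prod) auto
  also have "(\<lambda>x::'a. \<Prod>c\<in>Basis.
      (if c = b then (\<lambda>t. g t * std_normal_density t) else std_normal_density) (x \<bullet> c))
    = (\<lambda>x. g (x \<bullet> b) * gauss_density x)"
  proof
    fix x :: 'a
    have "(\<Prod>c\<in>Basis - {b}.
      (if c = b then (\<lambda>t. g t * std_normal_density t) else std_normal_density) (x \<bullet> c))
      = (\<Prod>c\<in>Basis - {b}. std_normal_density (x \<bullet> c))"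
      by (intro prod.cong) auto
    then show "(\<Prod>c\<in>Basis.
      (if c = b then (\<lambda>t. g t * std_normal_density t) else std_normal_density) (x \<bullet> c))
      = g (x \<bullet> b) * gauss_density x"
      unfolding gauss_density_def by (simp add: prod.remove[OF finite_Basis b])
  qed
  finally show ?thesis .
qed

lemma gauss_density_integrable_norm:
  "integrable lborel (\<lambda>x::'a::euclidean_space. norm x * gauss_density x)"
proof (rule Bochner_Integration.integrable_bound)
  have "integrable lborel (\<lambda>t. \<bar>t\<bar> * std_normal_density t)"
    using integrable_std_normal_moment_abs[of 1] by (simp add: mult.commute)
  then show "integrable lborel (\<lambda>x::'a. \<Sum>b\<in>Basis. \<bar>x \<bullet> b\<bar> * gauss_density x)"
    by (intro Bochner_Integration.integrable_sum gauss_density_integrable_coord)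
  show "AE x::'a in lborel. norm (norm x * gauss_density x) \<le> norm (\<Sum>b\<in>Basis. \<bar>x \<bullet> b\<bar> * gauss_density x)"
    using norm_le_l1 by (intro AE_I2) (auto simp: sum_distrib_right[symmetric] abs_mult gauss_density_nonneg
        sum_nonneg intro!: mult_right_mono)
qed auto

lemma fourier_std_normal:
  shows "(\<integral>x. complex_of_real (std_normal_density x) * exp (- \<i> * complex_of_real (x * w)) \<partial>lborel)
     = complex_of_real (exp (- w\<^sup>2 / 2))"
  and "integrable lborel (\<lambda>x. complex_of_real (std_normal_density x) * exp (- \<i> * complex_of_real (x * w)))"
proof -
  \<comment> \<open>The characteristic function has the opposite sign in the exponent, hence the
    argument \<open>-w\<close>.\<close>
  have "char std_normal_distribution (-w) = complex_of_real (exp (- w\<^sup>2 / 2))"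
    by (simp add: char_std_normal_distribution)
  also have "char std_normal_distribution (-w) = 
    (\<integral>x. std_normal_density x *\<^sub>R exp (\<i> * complex_of_real (-w * x)) \<partial>lborel)"
    unfolding char_def by (subst integral_density) (auto simp: normal_density_nonneg)
  finally show "(\<integral>x. complex_of_real (std_normal_density x) * exp (- \<i> * complex_of_real (x * w)) \<partial>lborel)
     = complex_of_real (exp (- w\<^sup>2 / 2))"
    by (simp add: scaleR_conv_of_real mult.commute)
  show "integrable lborel (\<lambda>x. complex_of_real (std_normal_density x) * exp (- \<i> * complex_of_real (x * w)))"
    by (rule Bochner_Integration.integrable_bound[OF integrable_normal_density[of 1 0]])
      (auto simp: norm_mult)
qed

lemma fourier_gauss_density:
  fixes w :: "'a::euclidean_space"
  shows "(\<integral>x. complex_of_real (gauss_density x) * exp (- \<i> * complex_of_real (x \<bullet> w)) \<partial>lborel)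
     = complex_of_real (exp (- (w \<bullet> w) / 2))"
proof -
  let ?f = "\<lambda>b x. complex_of_real (std_normal_density x) * exp (- \<i> * complex_of_real (x * (w \<bullet> b)))"
  have "complex_of_real (gauss_density x) * exp (- \<i> * complex_of_real (x \<bullet> w))
      = (\<Prod>b\<in>Basis. ?f b (x \<bullet> b))" for x :: 'a
  proof -
    have "exp (- \<i> * complex_of_real (x \<bullet> w)) = (\<Prod>b\<in>Basis. exp (- \<i> * complex_of_real ((x \<bullet> b) * (w \<bullet> b))))"
      unfolding euclidean_inner[of x w] by (simp add: exp_sum[symmetric] sum_distrib_left sum_negf)
    then show ?thesis by (simp add: gauss_density_def prod.distrib)
  qed
  then have "(\<integral>x. complex_of_real (gauss_density x) * exp (- \<i> * complex_of_real (x \<bullet> w)) \<partial>lborel)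
      = (\<integral>x. (\<Prod>b\<in>Basis. ?f b (x \<bullet> b)) \<partial>lborel)"
    by (simp only:)
  also have "\<dots> = (\<Prod>b\<in>Basis. integral\<^sup>L lborel (?f b))"
    by (rule lborel_integrable_prod(2)) (rule fourier_std_normal(2))
  also have "\<dots> = (\<Prod>b\<in>Basis. complex_of_real (exp (- (w \<bullet> b)\<^sup>2 / 2)))"
    by (simp only: fourier_std_normal(1))
  also have "\<dots> = complex_of_real (exp (\<Sum>b\<in>Basis. - (w \<bullet> b)\<^sup>2 / 2))"
    by (simp add: exp_sum)
  also have "(\<Sum>b\<in>Basis. - (w \<bullet> b)\<^sup>2 / 2) = - (w \<bullet> w) / 2"
    unfolding euclidean_inner[of w w] by (simp add: power2_eq_square sum_negf sum_divide_distrib)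
  finally show ?thesis .
qed

section \<open>Gaussians as test functions\<close>

text \<open>For the induction over iterated partial derivatives in \<open>schwartz_gaussian\<close>:
  differentiation in a fixed direction must not leave the polynomials.\<close>

lemma real_polynomial_function_directional_derivative:
  assumes "real_polynomial_function P"
  shows "\<exists>P'. real_polynomial_function P' \<and> (\<forall>x. \<exists>D. (P has_derivative D) (at x) \<and> D e = P' x)"
  using assms
proof induction
  case (linear f)
  then show ?case
    by (intro exI[of _ "\<lambda>_. f e"]) (auto intro: bounded_linear_imp_has_derivative)
next
  case (const c)
  then show ?case by (intro exI[of _ "\<lambda>_. 0"]) (auto intro!: exI[of _ "\<lambda>_. 0"])
next
  case (add f g)
  then obtain f' g' where *: "real_polynomial_function f'" "real_polynomial_function g'"
    "\<And>x. \<exists>D. (f has_derivative D) (at x) \<and> D e = f' x"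
    "\<And>x. \<exists>D. (g has_derivative D) (at x) \<and> D e = g' x" by blast
  have "\<exists>D. ((\<lambda>x. f x + g x) has_derivative D) (at x) \<and> D e = f' x + g' x" for x
  proof -
    obtain D E where "(f has_derivative D) (at x)" "D e = f' x" "(g has_derivative E) (at x)" "E e = g' x"
      using *(3,4)[of x] by blast
    then show ?thesis by (intro exI conjI) (rule has_derivative_add, assumption+, simp)
  qed
  with *(1,2) show ?case by (intro exI[of _ "\<lambda>x. f' x + g' x"]) auto
next
  case (mult f g)
  then obtain f' g' where *: "real_polynomial_function f'" "real_polynomial_function g'"
    "\<And>x. \<exists>D. (f has_derivative D) (at x) \<and> D e = f' x"
    "\<And>x. \<exists>D. (g has_derivative D) (at x) \<and> D e = g' x" by blast
  have "\<exists>D. ((\<lambda>x. f x * g x) has_derivative D) (at x) \<and> D e = f x * g' x + f' x * g x" for x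
  proof -
    obtain D E where "(f has_derivative D) (at x)" "D e = f' x" "(g has_derivative E) (at x)" "E e = g' x"
      using *(3,4)[of x] by blast
    then show ?thesis by (intro exI conjI) (rule has_derivative_mult, assumption+, simp)
  qed
  with *(1,2) mult.hyps show ?case by (intro exI[of _ "\<lambda>x. f x * g' x + f' x * g x"]) auto
qed

lemma real_polynomial_function_growth:
  assumes "real_polynomial_function P"
  shows "\<exists>C m. 0 \<le> C \<and> (\<forall>x. \<bar>P x\<bar> \<le> C * (1 + norm x) ^ m)"
  using assms
proof induction
  case (linear f)
  then obtain B where "0 \<le> B" "\<And>x. norm (f x) \<le> norm x * B" using bounded_linear.nonneg_bounded by blast
  then show ?case
    by (intro exI[of _ B] exI[of _ 1]) (auto simp: algebra_simps intro: order_trans[OF _ le_add_same_cancel2[THEN iffD2]])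
next
  case (const c)
  then show ?case by (intro exI[of _ "\<bar>c\<bar>"] exI[of _ 0]) auto
next
  case (add f g)
  then obtain C D m k where *: "0 \<le> C" "0 \<le> D" "\<And>x. \<bar>f x\<bar> \<le> C * (1 + norm x) ^ m"
    "\<And>x. \<bar>g x\<bar> \<le> D * (1 + norm x) ^ k" by blast
  have "\<bar>f x + g x\<bar> \<le> (C + D) * (1 + norm x) ^ (m + k)" for x
  proof -
    have "\<bar>f x + g x\<bar> \<le> C * (1 + norm x) ^ m + D * (1 + norm x) ^ k"
      using *(3,4)[of x] by linarith
    also have "\<dots> \<le> C * (1 + norm x) ^ (m + k) + D * (1 + norm x) ^ (m + k)"
      using *(1,2) by (intro add_mono mult_left_mono power_increasing) auto
    finally show ?thesis by (simp add: algebra_simps)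
  qed
  with * show ?case by (intro exI[of _ "C + D"] exI[of _ "m + k"]) auto
next
  case (mult f g)
  then obtain C D m k where *: "0 \<le> C" "0 \<le> D" "\<And>x. \<bar>f x\<bar> \<le> C * (1 + norm x) ^ m"
    "\<And>x. \<bar>g x\<bar> \<le> D * (1 + norm x) ^ k" by blast
  have "\<bar>f x * g x\<bar> \<le> (C * D) * (1 + norm x) ^ (m + k)" for x
  proof -
    have "\<bar>f x * g x\<bar> \<le> (C * (1 + norm x) ^ m) * (D * (1 + norm x) ^ k)"
      unfolding abs_mult using * by (intro mult_mono) auto
    then show ?thesis by (simp add: power_add mult_ac)
  qed
  with * show ?case by (intro exI[of _ "C * D"] exI[of _ "m + k"]) auto
qed

text \<open>Differentiation in a direction \<open>e\<close> turns a polynomial factor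
  \<open>P\<close> into \<open>P' - P * (V x \<bullet> V e)\<close>, so all derivatives are
  polynomials times the Gaussian. The left inverse \<open>W\<close> bounds |x| by a multiple of |V
  x|, so polynomial growth in x is beaten by the quadratic exponent in V x.\<close>

lemma schwartz_gaussian:
  fixes V :: "real^'n \<Rightarrow> real^'n"
  assumes V: "bounded_linear V" and W: "bounded_linear W" "\<And>x. W (V x) = x"
  shows "schwartz_function (\<lambda>x. complex_of_real (exp (- (V x \<bullet> V x) / 2)))"
proof -
  let ?E = "\<lambda>x. exp (- (V x \<bullet> V x) / 2)"
  have dE: "(?E has_derivative (\<lambda>h. - (V x \<bullet> V h) * ?E x)) (at x)" for x
  proof -
    have "((\<lambda>x. V x \<bullet> V x) has_derivative (\<lambda>h. V x \<bullet> V h + V h \<bullet> V x)) (at x)"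
      by (intro has_derivative_inner bounded_linear_imp_has_derivative V)
    then have "((\<lambda>x. (-1/2) * (V x \<bullet> V x)) has_derivative (\<lambda>h. (-1/2) * (V x \<bullet> V h + V h \<bullet> V x))) (at x)"
      by (rule has_derivative_mult_right)
    then have "((\<lambda>x. exp ((-1/2) * (V x \<bullet> V x))) has_derivative
        (\<lambda>h. (-1/2) * (V x \<bullet> V h + V h \<bullet> V x) * exp ((-1/2) * (V x \<bullet> V x)))) (at x)"
      by (rule has_derivative_exp)
    then show ?thesis by (simp add: inner_commute mult.commute)
  qed
  have *: "\<exists>P'. real_polynomial_function P' \<and>
      (\<forall>x. \<exists>D. ((\<lambda>x. complex_of_real (P x * ?E x)) has_derivative D) (at x)
        \<and> D e = complex_of_real (P' x * ?E x))"
    if P: "real_polynomial_function P" for P e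
  proof -
    obtain P' where P': "real_polynomial_function P'"
      "\<And>x. \<exists>D. (P has_derivative D) (at x) \<and> D e = P' x"
      using real_polynomial_function_directional_derivative[OF P] by blast
    have lin: "bounded_linear (\<lambda>x. V x \<bullet> V e)"
      by (rule bounded_linear_compose[OF bounded_linear_inner_left V])
    have "\<exists>D. ((\<lambda>x. complex_of_real (P x * ?E x)) has_derivative D) (at x)
        \<and> D e = complex_of_real ((P' x - P x * (V x \<bullet> V e)) * ?E x)" for x
    proof -
      obtain D where D: "(P has_derivative D) (at x)" "D e = P' x" using P'(2) by blast
      have "((\<lambda>x. complex_of_real (P x * ?E x)) has_derivative
        (\<lambda>h. complex_of_real (P x * (- (V x \<bullet> V h) * ?E x) + D h * ?E x))) (at x)"
        by (intro has_derivative_of_real has_derivative_mult D dE)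
      then show ?thesis using D(2) by (intro exI conjI) (assumption, simp add: algebra_simps)
    qed
    moreover have "real_polynomial_function (\<lambda>x. P' x - P x * (V x \<bullet> V e))"
      by (intro real_polynomial_function_diff P' real_polynomial_function.intros(4) P
          real_polynomial_function.intros(1) lin)
    ultimately show ?thesis by (intro exI[of _ "\<lambda>x. P' x - P x * (V x \<bullet> V e)"]) blast
  qed
  have form: "\<exists>P. real_polynomial_function P \<and>
      foldr partial_derivative is (\<lambda>x. complex_of_real (?E x)) = (\<lambda>x. complex_of_real (P x * ?E x))" for "is"
  proof (induction "is")
    case Nil
    show ?case by (intro exI[of _ "\<lambda>_. 1"]) auto
  next
    case (Cons i "is")
    then obtain P where P: "real_polynomial_function P"
      "foldr partial_derivative is (\<lambda>x. complex_of_real (?E x)) = (\<lambda>x. complex_of_real (P x * ?E x))"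
      by blast
    obtain P' where P': "real_polynomial_function P'"
      "\<And>x. \<exists>D. ((\<lambda>x. complex_of_real (P x * ?E x)) has_derivative D) (at x)
        \<and> D (axis i 1) = complex_of_real (P' x * ?E x)"
      using *[OF P(1)] by blast
    have "partial_derivative i (\<lambda>x. complex_of_real (P x * ?E x)) x = complex_of_real (P' x * ?E x)" for x
    proof -
      obtain D where D: "((\<lambda>x. complex_of_real (P x * ?E x)) has_derivative D) (at x)"
        "D (axis i 1) = complex_of_real (P' x * ?E x)" using P'(2)[of x] by blast
      show ?thesis unfolding partial_derivative_def frechet_derivative_at[OF D(1), symmetric] by (rule D(2))
    qed
    then have "foldr partial_derivative (i # is) (\<lambda>x. complex_of_real (?E x))
        = (\<lambda>x. complex_of_real (P' x * ?E x))"
      by (simp only: foldr_Cons comp_apply P(2)) (rule ext)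
    with P'(1) show ?case by blast
  qed
  obtain B where B: "0 \<le> B" "\<And>x. norm (W x) \<le> norm x * B"
    using bounded_linear.nonneg_bounded[OF W(1)] by blast
  show ?thesis
    unfolding schwartz_function_def
  proof (intro allI conjI)
    fix "is" :: "'n list"
    obtain P where P: "real_polynomial_function P"
      "foldr partial_derivative is (\<lambda>x. complex_of_real (?E x)) = (\<lambda>x. complex_of_real (P x * ?E x))"
      using form by blast
    show "foldr partial_derivative is (\<lambda>x. complex_of_real (?E x)) differentiable at x" for x
      unfolding P(2) differentiable_def using *[OF P(1)] by blast
    fix k :: nat
    obtain C m where C: "0 \<le> C" "\<And>x. \<bar>P x\<bar> \<le> C * (1 + norm x) ^ m"
      using real_polynomial_function_growth[OF P(1)] by blast
    define j where "j = k + m"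
    \<comment> \<open>After 1 + s has been bounded by exp s with s = |V x|, the exponent is j s -
      s^2/2, whose maximum over s is j^2/2.\<close>
    have "norm x ^ k * (\<bar>P x\<bar> * ?E x) \<le> C * (1 + B) ^ j * exp (real j ^ 2 / 2)" for x
    proof -
      let ?s = "norm (V x)"
      have "norm x \<le> B * ?s" using B(2)[of "V x"] W(2) by (simp add: mult.commute)
      then have "1 + norm x \<le> (1 + B) * (1 + ?s)"
        using B(1) norm_ge_zero[of "V x"] by (simp add: algebra_simps del: norm_ge_zero)
      also have "\<dots> \<le> (1 + B) * exp ?s" using B(1) by (intro mult_left_mono exp_ge_add_one_self) auto
      finally have le: "1 + norm x \<le> (1 + B) * exp ?s" .
      have "norm x ^ k * (\<bar>P x\<bar> * ?E x) \<le> (1 + norm x) ^ k * ((C * (1 + norm x) ^ m) * ?E x)"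
      proof (rule mult_mono)
        show "norm x ^ k \<le> (1 + norm x) ^ k" by (rule power_mono) auto
        show "\<bar>P x\<bar> * ?E x \<le> (C * (1 + norm x) ^ m) * ?E x" by (rule mult_right_mono[OF C(2)]) simp
      qed auto
      also have "\<dots> = C * (1 + norm x) ^ j * ?E x" by (simp add: j_def power_add)
      also have "\<dots> \<le> C * ((1 + B) * exp ?s) ^ j * ?E x"
        by (intro mult_right_mono mult_left_mono power_mono le C) auto
      also have "\<dots> = C * (1 + B) ^ j * exp (real j * ?s - ?s\<^sup>2 / 2)"
      proof -
        have "exp ?s ^ j = exp (real j * ?s)" by (simp add: exp_of_nat_mult)
        moreover have "V x \<bullet> V x = ?s\<^sup>2" by (simp add: dot_square_norm)
        ultimately show ?thesis by (simp add: power_mult_distrib exp_add[symmetric])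
      qed
      also have "\<dots> \<le> C * (1 + B) ^ j * exp (real j ^ 2 / 2)"
      proof (intro mult_left_mono)
        have "0 \<le> (real j - ?s)\<^sup>2" by simp
        then have "real j * ?s - ?s\<^sup>2 / 2 \<le> real j ^ 2 / 2" by (simp add: power2_diff)
        then show "exp (real j * ?s - ?s\<^sup>2 / 2) \<le> exp (real j ^ 2 / 2)" by simp
      qed (use B C in auto)
      finally show ?thesis .
    qed
    then show "bounded (range (\<lambda>x. norm x ^ k *\<^sub>R foldr partial_derivative is (\<lambda>x. complex_of_real (?E x)) x))"
      unfolding P(2)
      by (intro boundedI[of _ "C * (1 + B) ^ j * exp (real j ^ 2 / 2)"])
        (auto simp del: of_real_mult simp: abs_mult)
  qed
qed

section \<open>The Minkowski functional\<close>

text \<open>\<open>LEAST\<close> on the reals says something only if the minimum is attained.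
  Candidates up to |x| / r suffice, and these form the projection of a compact set of pairs (a,
  y).\<close>

lemma minkowski_functional_least:
  fixes K :: "(real^'n) set"
  assumes K: "compact K" and r: "r > 0" "cball 0 r \<subseteq> K"
  shows "0 \<le> minkowski_functional K x"
    and "\<exists>y\<in>K. x = minkowski_functional K x *\<^sub>R y"
    and "\<And>a y. 0 \<le> a \<Longrightarrow> y \<in> K \<Longrightarrow> x = a *\<^sub>R y \<Longrightarrow> minkowski_functional K x \<le> a"
    and "minkowski_functional K x \<le> norm x / r"
proof -
  define M where "M = norm x / r"
  let ?y0 = "if x = 0 then 0 else (r / norm x) *\<^sub>R x"
  have y0: "?y0 \<in> K" "x = M *\<^sub>R ?y0"
    using r by (auto simp: M_def subset_iff)
  let ?X = "({0..M} \<times> K) \<inter> (\<lambda>(a, y). a *\<^sub>R y) -` {x}"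
  have "closed ((\<lambda>(a, y). a *\<^sub>R y) -` {x} :: (real \<times> (real^'n)) set)"
    by (intro closed_vimage) (auto intro!: continuous_intros simp: case_prod_unfold)
  then have "compact ?X" by (intro compact_Int_closed compact_Times K) auto
  then have "compact (fst ` ?X)" by (intro compact_continuous_image continuous_intros)
  moreover have "(M, ?y0) \<in> ?X" using y0 r by (auto simp: M_def)
  then have "M \<in> fst ` ?X" by force
  ultimately obtain a where a: "a \<in> fst ` ?X" "\<forall>b\<in>fst ` ?X. a \<le> b"
    using compact_attains_inf[of "fst ` ?X"] by blast
  then obtain y where y: "0 \<le> a" "a \<le> M" "y \<in> K" "a *\<^sub>R y = x" by auto
  have least: "a \<le> b" if "0 \<le> b" "z \<in> K" "x = b *\<^sub>R z" for b z
  proof (cases "b \<le> M")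
    case True
    then have "b \<in> fst ` ?X" using that by force
    with a(2) show ?thesis by blast
  qed (use y in linarith)
  have eq: "minkowski_functional K x = a"
    unfolding minkowski_functional_def by (rule Least_equality) (use y least in auto)
  show "0 \<le> minkowski_functional K x" "minkowski_functional K x \<le> norm x / r"
    using eq y by (auto simp: M_def)
  show "\<exists>y\<in>K. x = minkowski_functional K x *\<^sub>R y"
    by (rule bexI[OF _ y(3)]) (simp add: eq y(4))
  show "minkowski_functional K x \<le> b" if "0 \<le> b" "z \<in> K" "x = b *\<^sub>R z" for b z
    using least[OF that] eq by simp
qed

text \<open>Everything the later argument needs about a star body. The lower bound comes from
  boundedness, the upper one from the ball inside \<open>K\<close>, and the absolute value in the
  homogeneity from symmetry.\<close>

lemma symmetric_star_body_gauge:
  fixes K :: "(real^'n) set"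
  assumes "symmetric_star_body K"
  obtains c C where "0 < c" "0 < C" "\<And>x. c * norm x \<le> minkowski_functional K x"
    "\<And>x. minkowski_functional K x \<le> C * norm x"
    "\<And>t x. minkowski_functional K (t *\<^sub>R x) = \<bar>t\<bar> * minkowski_functional K x"
    "continuous_on (- {0}) (minkowski_functional K)"
proof -
  let ?N = "minkowski_functional K"
  from assms have K: "compact K" "uminus ` K = K"
    "continuous_on (sphere 0 1) (\<lambda>x. inverse (?N x))" "0 \<in> interior K"
    unfolding symmetric_star_body_def by auto
  obtain r where r: "r > 0" "cball 0 r \<subseteq> K" using K(4) unfolding mem_interior_cball by blast
  note N = minkowski_functional_least[OF K(1) r]
  obtain R where R: "R > 0" "\<And>y. y \<in> K \<Longrightarrow> norm y \<le> R"
    using compact_imp_bounded[OF K(1)] unfolding bounded_pos by blast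
  have lower: "(1 / R) * norm x \<le> ?N x" for x
  proof -
    obtain y where y: "y \<in> K" "x = ?N x *\<^sub>R y" using N(2) by blast
    have "norm x = ?N x * norm y" using y(2) N(1)[of x] by (metis abs_of_nonneg norm_scaleR)
    also have "\<dots> \<le> ?N x * R" using R(2)[OF y(1)] N(1) by (intro mult_left_mono) auto
    finally show ?thesis using R(1) by (simp add: field_simps)
  qed
  have upper: "?N x \<le> (1 / r) * norm x" for x using N(4)[of x] by simp
  have N0: "?N 0 = 0" using upper[of 0] N(1)[of 0] by simp
  \<comment> \<open>This inequality is enough: applied with \<open>inverse t\<close> it yields its
    converse.\<close>
  have le: "?N (t *\<^sub>R x) \<le> \<bar>t\<bar> * ?N x" for t x
  proof -
    obtain y where y: "y \<in> K" "x = ?N x *\<^sub>R y" using N(2) by blast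
    have "- y \<in> K" using y(1) K(2) by blast
    then show ?thesis
      using N(3)[of "\<bar>t\<bar> * ?N x" "if t \<ge> 0 then y else -y" "t *\<^sub>R x"] y N(1)[of x]
      by (auto simp: abs_if split: if_splits) (metis scaleR_scaleR)+
  qed
  have hom: "?N (t *\<^sub>R x) = \<bar>t\<bar> * ?N x" for t x
  proof (cases "t = 0")
    case False
    have "?N (inverse t *\<^sub>R (t *\<^sub>R x)) \<le> \<bar>inverse t\<bar> * ?N (t *\<^sub>R x)" by (rule le)
    then have "\<bar>t\<bar> * ?N x \<le> ?N (t *\<^sub>R x)" using False by (simp add: field_simps)
    with le[of t x] show ?thesis by simp
  qed (simp add: N0)
  have pos: "?N x > 0" if "x \<noteq> 0" for x
  proof -
    have "0 < (1 / R) * norm x" using that R by simp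
    with lower[of x] show ?thesis by linarith
  qed
  have cS: "continuous_on (sphere 0 1) ?N"
  proof -
    have "continuous_on (sphere 0 1) (\<lambda>x. inverse (inverse (?N x)))"
    proof (rule continuous_on_inverse[OF K(3)], rule ballI)
      fix x :: "real^'n" assume "x \<in> sphere 0 1"
      then have "x \<noteq> 0" by auto
      then show "inverse (?N x) \<noteq> 0" using pos[of x] by simp
    qed
    then show ?thesis by simp
  qed
  \<comment> \<open>Homogeneity spreads continuity from the sphere to the punctured space.\<close>
  have "continuous_on (- {0}) (\<lambda>x. norm x * ?N (inverse (norm x) *\<^sub>R x))"
  proof (intro continuous_on_mult continuous_on_norm continuous_on_id)
    show "continuous_on (- {0}) (\<lambda>x. ?N (inverse (norm x) *\<^sub>R x))"
      by (rule continuous_on_compose2[OF cS]) (auto intro!: continuous_intros simp: field_simps split: if_splits)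
  qed
  moreover have "norm x * ?N (inverse (norm x) *\<^sub>R x) = ?N x" if "x \<in> - {0}" for x
    using that by (simp add: hom)
  ultimately have "continuous_on (- {0}) ?N" by (rule continuous_on_eq)
  with that[of "1 / R" "1 / r"] R r lower upper hom show thesis by auto
qed

section \<open>The embedding identity on Gaussians\<close>

text \<open>The quadratic error is uniform on [-1, 1]; this controls the difference quotients in
  \<open>quotient_integral_tendsto\<close>.\<close>

lemma exp_minus_one_minus_bound:
  fixes x :: real
  assumes "\<bar>x\<bar> \<le> 1"
  shows "\<bar>exp x - 1 - x\<bar> \<le> x\<^sup>2"
proof (cases "x \<ge> 0")
  case True
  then have "exp x \<le> 1 + x + x\<^sup>2" using assms by (intro exp_bound) auto
  moreover have "1 + x \<le> exp x" by (rule exp_ge_add_one_self)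
  ultimately show ?thesis by linarith
next
  case False
  define y where "y = - x"
  have y: "0 \<le> y" "y \<le> 1" using False assms by (auto simp: y_def)
  \<comment> \<open>For negative x the bound comes from inverting this lower bound for exp y; the
    reciprocal is compared with 1 - y + y^2 by multiplying out.\<close>
  have "1 + y + y\<^sup>2 / 2 \<le> exp y" using exp_lower_Taylor_quadratic[OF y(1)] .
  then have "exp x \<le> 1 / (1 + y + y\<^sup>2 / 2)"
  proof -
    have "exp x = inverse (exp y)" by (simp add: y_def exp_minus)
    moreover have "0 < 1 + y + y\<^sup>2 / 2" using y by (simp add: add_pos_nonneg)
    ultimately show ?thesis
      using \<open>1 + y + y\<^sup>2 / 2 \<le> exp y\<close> by (simp only: inverse_eq_divide) (rule divide_left_mono; simp)
  qed
  also have "\<dots> \<le> 1 - y + y\<^sup>2"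
  proof -
    have "1 \<le> (1 - y + y\<^sup>2) * (1 + y + y\<^sup>2 / 2)"
    proof -
      have "(1 - y + y\<^sup>2) * (1 + y + y\<^sup>2 / 2) = 1 + y\<^sup>2 / 2 + y ^ 3 / 2 + y ^ 4 / 2"
        by (simp add: field_simps power2_eq_square power3_eq_cube power4_eq_xxxx)
      then show ?thesis using y by simp
    qed
    moreover have "1 + y + y\<^sup>2 / 2 > 0" using y by (simp add: add_pos_nonneg)
    ultimately show ?thesis by (simp add: divide_le_eq)
  qed
  finally have "exp x \<le> 1 + x + x\<^sup>2" by (simp add: y_def)
  moreover have "1 + x \<le> exp x" by (rule exp_ge_add_one_self)
  ultimately show ?thesis by linarith
qed

text \<open>With L = |ln a| the quotient is at most L exp (p L), and L is at most 4 exp (L/4). For p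
  up to 1/4 the product is at most 4 exp (L/2), and exp (L/2) is the larger of sqrt a and its
  inverse. The exponent 1/2 keeps the singularity integrable.\<close>

lemma powr_diff_quotient_bound:
  fixes a p :: real
  assumes "a > 0" "0 < p" "p \<le> 1/4"
  shows "\<bar>(a powr (-p) - 1) / p\<bar> \<le> 4 * (sqrt a + inverse (sqrt a))"
    and "\<bar>ln a\<bar> \<le> 4 * (sqrt a + inverse (sqrt a))"
proof -
  define L where "L = \<bar>ln a\<bar>"
  have e: "exp (L / 2) \<le> sqrt a + inverse (sqrt a)"
  proof -
    have s: "sqrt a = exp (ln a / 2)"
      using assms(1) by (simp add: powr_half_sqrt[symmetric] powr_def)
    show ?thesis unfolding s L_def by (cases "ln a \<ge> 0") (auto simp: exp_minus)
  qed
  have L4: "L \<le> 4 * exp (L / 4)" using exp_ge_add_one_self[of "L / 4"] by linarith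
  have L0: "0 \<le> L" by (simp add: L_def)
  have key: "\<bar>exp x - 1\<bar> \<le> \<bar>x\<bar> * exp \<bar>x\<bar>" for x :: real
  proof (cases "x \<ge> 0")
    case True
    have "(1 - x) * exp x \<le> exp (- x) * exp x"
      using exp_ge_add_one_self[of "- x"] by (intro mult_right_mono) auto
    then show ?thesis using True by (simp add: algebra_simps exp_minus)
  next
    case False
    have "- x * 1 \<le> - x * exp (- x)" using False by (intro mult_left_mono) auto
    then have "1 - exp x \<le> - x * exp (- x)" using exp_ge_add_one_self[of x] by linarith
    moreover have "exp x \<le> 1" using False by simp
    ultimately show ?thesis using False by simp
  qed
  have "a powr (-p) = exp (- p * ln a)" using assms by (simp add: powr_def)
  then have "\<bar>a powr (-p) - 1\<bar> \<le> (p * L) * exp (p * L)"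
    using key[of "- p * ln a"] assms by (simp add: L_def abs_mult)
  then have "\<bar>(a powr (-p) - 1) / p\<bar> \<le> L * exp (p * L)"
    using assms by (simp add: divide_le_eq mult_ac)
  also have "\<dots> \<le> (4 * exp (L / 4)) * exp (L / 4)"
    using L4 L0 assms by (intro mult_mono) (auto simp: mult_right_mono[of p "1/4" L, simplified])
  also have "\<dots> = 4 * exp (L / 2)" by (simp add: exp_add[symmetric])
  finally show "\<bar>(a powr (-p) - 1) / p\<bar> \<le> 4 * (sqrt a + inverse (sqrt a))" using e by (rule order_trans[OF _ mult_left_mono]) simp
  have "L / 4 \<le> L / 2" using L0 by simp
  then have "exp (L / 4) \<le> exp (L / 2)" by simp
  then show "\<bar>ln a\<bar> \<le> 4 * (sqrt a + inverse (sqrt a))" 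
    using order_trans[OF L4 mult_left_mono[OF order_trans[OF _ e], of _ 4]] unfolding L_def by simp
qed

lemma powr_diff_quotient_tendsto:
  fixes a :: real
  assumes "a > 0" "p \<longlonglongrightarrow> 0" "\<And>k. p k > 0"
  shows "(\<lambda>k. (a powr (- p k) - 1) / p k) \<longlonglongrightarrow> - ln a"
proof -
  have "((\<lambda>t. exp (- t * ln a)) has_real_derivative - ln a) (at 0)"
    by (auto intro!: derivative_eq_intros)
  then have "((\<lambda>h. (exp (- h * ln a) - 1) / h) \<longlongrightarrow> - ln a) (at 0)"
    by (simp add: DERIV_def)
  moreover have "filterlim p (at 0) sequentially"
    using assms by (auto simp: filterlim_at intro!: always_eventually less_imp_neq[symmetric])
  ultimately have "(\<lambda>k. (exp (- p k * ln a) - 1) / p k) \<longlonglongrightarrow> - ln a"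
    by (rule filterlim_compose)
  then show ?thesis using assms(1) by (simp add: powr_def)
qed

text \<open>The substitution of a t for t; with a = |\<open>W'\<close> \<xi>| it produces the power
  -p of that norm.\<close>

lemma gaussian_moment_scale:
  fixes a p :: real
  assumes "a > 0"
  shows "(\<integral>t. \<bar>t\<bar> powr (p - 1) * exp (- (t * a)\<^sup>2 / 2) \<partial>lborel)
    = a powr (-p) * (\<integral>t. \<bar>t\<bar> powr (p - 1) * exp (- t\<^sup>2 / 2) \<partial>lborel)"
proof -
  have "(\<integral>t. \<bar>t\<bar> powr (p - 1) * exp (- t\<^sup>2 / 2) \<partial>lborel)
      = a * (\<integral>t. \<bar>a * t\<bar> powr (p - 1) * exp (- (a * t)\<^sup>2 / 2) \<partial>lborel)"
    using lborel_integral_real_affine[of a "\<lambda>t. \<bar>t\<bar> powr (p - 1) * exp (- t\<^sup>2 / 2)" 0] assms by simp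
  also have "\<dots> = a * (\<integral>t. a powr (p - 1) * (\<bar>t\<bar> powr (p - 1) * exp (- (t * a)\<^sup>2 / 2)) \<partial>lborel)"
    using assms by (intro arg_cong[of _ _ "(*) a"] Bochner_Integration.integral_cong)
      (auto simp: abs_mult powr_mult mult.commute)
  also have "\<dots> = a powr p * (\<integral>t. \<bar>t\<bar> powr (p - 1) * exp (- (t * a)\<^sup>2 / 2) \<partial>lborel)"
    unfolding integral_mult_right_zero using assms powr_mult_base[of a "p - 1"] by simp
  finally show ?thesis using assms by (simp add: powr_minus field_simps)
qed

definition gauss_measure :: "'a::euclidean_space measure" where
  "gauss_measure = density lborel (\<lambda>x. ennreal (gauss_density x))"

lemma sets_gauss_measure [simp, measurable_cong]: "sets gauss_measure = sets borel"
  and space_gauss_measure [simp]: "space gauss_measure = UNIV"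
  by (simp_all add: gauss_measure_def)

lemma prob_space_gauss_measure: "prob_space (gauss_measure :: 'a::euclidean_space measure)"
proof
  have "emeasure (gauss_measure :: 'a measure) (space gauss_measure) = (\<integral>\<^sup>+x. ennreal (gauss_density (x::'a)) \<partial>lborel)"
    by (simp add: gauss_measure_def emeasure_density)
  also have "\<dots> = 1"
    by (subst nn_integral_eq_integral) (auto simp: gauss_density_integral gauss_density_nonneg)
  finally show "emeasure (gauss_measure :: 'a measure) (space gauss_measure) = 1" .
qed

lemma integrable_gauss_measure:
  fixes f :: "'a::euclidean_space \<Rightarrow> real"
  assumes "f \<in> borel_measurable borel" "integrable lborel (\<lambda>x. f x * gauss_density x)"
  shows "integrable gauss_measure f"
  unfolding gauss_measure_def using assms
  by (subst integrable_density) (auto simp: gauss_density_nonneg mult.commute)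

lemma AE_gauss_coordinate_neq_0:
  fixes e :: "'a::euclidean_space"
  assumes "e \<noteq> 0"
  shows "AE z in gauss_measure. z \<bullet> e \<noteq> 0"
proof -
  have "{z. e \<bullet> z = 0} \<in> null_sets lebesgue"
    using negligible_hyperplane[of e 0] assms by (simp add: negligible_iff_null_sets)
  then have "{z. z \<bullet> e = 0} \<in> null_sets lborel"
    by (simp add: inner_commute null_sets_def null_sets_completion_iff)
  then have "AE z in lborel. z \<bullet> e \<noteq> 0" by (simp add: AE_iff_null_sets)
  then show ?thesis unfolding gauss_measure_def by (subst AE_density) auto
qed

text \<open>The substitution x = W z turns the test function into the standard Gaussian up to the
  factor c / C, where c is the Jacobian and C the normalising constant. The same factor stands in
  front of the Fourier transform, which is a Gaussian in \<open>W'\<close> \<eta>, so it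
  cancels.\<close>

lemma embedding_gaussian:
  fixes N :: "real^'n \<Rightarrow> real" and W V W' :: "real^'n \<Rightarrow> real^'n" and \<mu> :: "(real^'n) measure"
  assumes N [measurable]: "N \<in> borel_measurable borel"
    and \<mu>: "sets \<mu> = sets (restrict_space borel (sphere 0 1))"
    and emb: "\<And>\<phi>. schwartz_function \<phi> \<Longrightarrow> (LINT x|lborel. (N x powr (-p)) *\<^sub>R \<phi> x) =
      (LINT \<xi>|\<mu>. (LINT t|lborel. (\<bar>t\<bar> powr (p - 1)) *\<^sub>R fourier_transform \<phi> (t *\<^sub>R \<xi>)))"
    and lin: "linear W" "linear V" "linear W'"
    and inv: "\<And>x. W (V x) = x" "\<And>x. V (W x) = x"
    and adj: "\<And>z \<xi>. W z \<bullet> \<xi> = z \<bullet> W' \<xi>"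
  shows "(\<integral>z. N (W z) powr (-p) \<partial>gauss_measure)
    = (\<integral>t. \<bar>t\<bar> powr (p - 1) * exp (- t\<^sup>2 / 2) \<partial>lborel) * (\<integral>\<xi>. norm (W' \<xi>) powr (-p) \<partial>\<mu>)"
proof -
  define \<kappa> where "\<kappa> = (\<integral>t. \<bar>t\<bar> powr (p - 1) * exp (- t\<^sup>2 / 2) \<partial>lborel)"
  define \<phi> where "\<phi> x = complex_of_real (exp (- (V x \<bullet> V x) / 2))" for x
  have [measurable]: "W \<in> borel_measurable borel" "V \<in> borel_measurable borel"
    using lin by (auto intro: linear_borel_measurable)
  have [measurable]: "\<phi> \<in> borel_measurable borel" unfolding \<phi>_def by measurable
  have \<phi>: "schwartz_function \<phi>"
    unfolding \<phi>_def using lin inv by (intro schwartz_gaussian[of V W]) (auto simp: linear_linear)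
  obtain C where C: "C > 0" "\<And>x::real^'n. gauss_density x = C * exp (- (x \<bullet> x) / 2)"
    using gauss_density_eq by blast
  then have C': "exp (- (x \<bullet> x / 2)) = gauss_density x / C" for x :: "real^'n" by simp
  obtain c :: real where c: "c > 0" "\<And>f::real^'n \<Rightarrow> complex. f \<in> borel_measurable borel \<Longrightarrow>
      (\<integral>y. f y \<partial>lborel) = c *\<^sub>R (\<integral>z. f (W z) \<partial>lborel)"
    using lborel_integral_linear[OF lin(1,2) inv] by blast
  have fourier: "fourier_transform \<phi> \<eta> = complex_of_real (c / C * exp (- (norm (W' \<eta>))\<^sup>2 / 2))" for \<eta>
  proof -
    have "fourier_transform \<phi> \<eta> = c *\<^sub>R (\<integral>z. \<phi> (W z) * exp (- \<i> * complex_of_real (W z \<bullet> \<eta>)) \<partial>lborel)"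
      unfolding fourier_transform_def by (rule c(2)) measurable
    also have "(\<integral>z. \<phi> (W z) * exp (- \<i> * complex_of_real (W z \<bullet> \<eta>)) \<partial>lborel)
        = (\<integral>z. complex_of_real (1 / C) * (complex_of_real (gauss_density z) * exp (- \<i> * complex_of_real (z \<bullet> W' \<eta>))) \<partial>lborel)"
      by (intro Bochner_Integration.integral_cong refl) (simp add: \<phi>_def inv adj C')
    also have "\<dots> = complex_of_real (1 / C) * complex_of_real (exp (- (W' \<eta> \<bullet> W' \<eta>) / 2))"
      by (simp only: integral_mult_right_zero fourier_gauss_density)
    finally show ?thesis by (simp add: scaleR_conv_of_real dot_square_norm)
  qed
  have "(\<integral>x. (N x powr (-p)) *\<^sub>R \<phi> x \<partial>lborel) = c *\<^sub>R (\<integral>z. (N (W z) powr (-p)) *\<^sub>R \<phi> (W z) \<partial>lborel)"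
    by (rule c(2)) measurable
  also have "(\<integral>z. (N (W z) powr (-p)) *\<^sub>R \<phi> (W z) \<partial>lborel)
      = (\<integral>z. complex_of_real (1 / C * (gauss_density z * N (W z) powr (-p))) \<partial>lborel)"
    by (intro Bochner_Integration.integral_cong refl) (simp add: \<phi>_def inv C' scaleR_conv_of_real)
  also have "\<dots> = complex_of_real (1 / C * (\<integral>z. gauss_density z * N (W z) powr (-p) \<partial>lborel))"
    by (simp only: integral_complex_of_real integral_mult_right_zero)
  also have "(\<integral>z. gauss_density z * N (W z) powr (-p) \<partial>lborel) = (\<integral>z. N (W z) powr (-p) \<partial>gauss_measure)"
    unfolding gauss_measure_def by (subst integral_density) (auto simp: gauss_density_nonneg)
  finally have L: "(\<integral>x. (N x powr (-p)) *\<^sub>R \<phi> x \<partial>lborel)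
      = complex_of_real (c / C * (\<integral>z. N (W z) powr (-p) \<partial>gauss_measure))"
    by (simp add: scaleR_conv_of_real)
  have space: "space \<mu> = sphere 0 1"
    using sets_eq_imp_space_eq[OF \<mu>] by (simp add: space_restrict_space)
  have "(LINT \<xi>|\<mu>. (LINT t|lborel. (\<bar>t\<bar> powr (p - 1)) *\<^sub>R fourier_transform \<phi> (t *\<^sub>R \<xi>)))
      = (LINT \<xi>|\<mu>. complex_of_real (c / C * (\<kappa> * norm (W' \<xi>) powr (-p))))"
  proof (intro Bochner_Integration.integral_cong refl)
    fix \<xi> assume "\<xi> \<in> space \<mu>"
    then have "norm \<xi> = 1" by (simp add: space)
    \<comment> \<open>Since \<open>W\<close> has the right inverse \<open>V\<close>, the square norm
      of \<xi> equals \<open>V \<xi> \<bullet> W' \<xi>\<close>.\<close>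
    have "W' \<xi> \<noteq> 0"
    proof
      assume "W' \<xi> = 0"
      then have "\<xi> \<bullet> \<xi> = 0" using adj[of "V \<xi>" \<xi>] inv by simp
      with \<open>norm \<xi> = 1\<close> show False by simp
    qed
    then have pos: "norm (W' \<xi>) > 0" by simp
    have "(LINT t|lborel. (\<bar>t\<bar> powr (p - 1)) *\<^sub>R fourier_transform \<phi> (t *\<^sub>R \<xi>))
       = (LINT t|lborel. complex_of_real (c / C * (\<bar>t\<bar> powr (p - 1) * exp (- (t * norm (W' \<xi>))\<^sup>2 / 2))))"
    proof (intro Bochner_Integration.integral_cong refl)
      fix t :: real
      have n: "norm (W' (t *\<^sub>R \<xi>)) = \<bar>t\<bar> * norm (W' \<xi>)" by (simp add: linear_scale[OF lin(3)])
      show "(\<bar>t\<bar> powr (p - 1)) *\<^sub>R fourier_transform \<phi> (t *\<^sub>R \<xi>)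
        = complex_of_real (c / C * (\<bar>t\<bar> powr (p - 1) * exp (- (t * norm (W' \<xi>))\<^sup>2 / 2)))"
        unfolding fourier n by (simp add: scaleR_conv_of_real power_mult_distrib)
    qed
    also have "\<dots> = complex_of_real (c / C * (norm (W' \<xi>) powr (-p) * \<kappa>))"
      unfolding integral_complex_of_real integral_mult_right_zero gaussian_moment_scale[OF pos] \<kappa>_def ..
    finally show "(LINT t|lborel. (\<bar>t\<bar> powr (p - 1)) *\<^sub>R fourier_transform \<phi> (t *\<^sub>R \<xi>))
      = complex_of_real (c / C * (\<kappa> * norm (W' \<xi>) powr (-p)))" by (simp only: mult.commute[of \<kappa>])
  qed
  also have "\<dots> = complex_of_real (c / C * (\<kappa> * (\<integral>\<xi>. norm (W' \<xi>) powr (-p) \<partial>\<mu>)))"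
    by (simp only: integral_complex_of_real integral_mult_right_zero)
  finally have "complex_of_real (c / C * (\<integral>z. N (W z) powr (-p) \<partial>gauss_measure))
      = complex_of_real (c / C * (\<kappa> * (\<integral>\<xi>. norm (W' \<xi>) powr (-p) \<partial>\<mu>)))"
    using emb[OF \<phi>] L by simp
  then have "c / C * (\<integral>z. N (W z) powr (-p) \<partial>gauss_measure)
      = c / C * (\<kappa> * (\<integral>\<xi>. norm (W' \<xi>) powr (-p) \<partial>\<mu>))"
    unfolding of_real_eq_iff .
  then show ?thesis using c(1) C(1) unfolding \<kappa>_def by simp
qed

text \<open>For \<open>h \<rightarrow> 0\<close> the invertible maps \<open>W h\<close> degenerate to the rank one map \<open>z \<mapsto> (z, e) x0\<close>.\<close>

lemma stretch_map:
  fixes x0 e :: "real^'n"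
  assumes x0: "x0 \<noteq> 0" and e: "norm e = 1"
  obtains W V W' :: "real \<Rightarrow> real^'n \<Rightarrow> real^'n"
  where "\<And>h. h > 0 \<Longrightarrow> linear (W h)" "\<And>h. h > 0 \<Longrightarrow> linear (V h)" "\<And>h. h > 0 \<Longrightarrow> linear (W' h)"
    "\<And>h x. h > 0 \<Longrightarrow> W h (V h x) = x" "\<And>h x. h > 0 \<Longrightarrow> V h (W h x) = x"
    "\<And>h z \<xi>. h > 0 \<Longrightarrow> W h z \<bullet> \<xi> = z \<bullet> W' h \<xi>"
    "\<And>h z. h > 0 \<Longrightarrow> (norm (W h z))\<^sup>2 = h\<^sup>2 * ((norm z)\<^sup>2 - (z \<bullet> e)\<^sup>2) + (norm x0)\<^sup>2 * (z \<bullet> e)\<^sup>2"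
    "\<And>h \<xi>. h > 0 \<Longrightarrow> (norm (W' h \<xi>))\<^sup>2 = h\<^sup>2 * ((norm \<xi>)\<^sup>2 - (\<xi> \<bullet> x0)\<^sup>2 / (norm x0)\<^sup>2) + (\<xi> \<bullet> x0)\<^sup>2"
    "\<And>h z. h > 0 \<Longrightarrow> norm (W h z - (z \<bullet> e) *\<^sub>R x0) \<le> 2 * h * norm z"
proof -
  define a where "a = norm x0"
  have a: "a > 0" using x0 by (simp add: a_def)
  have "norm (a *\<^sub>R e) = norm x0" using e by (simp add: a_def)
  \<comment> \<open>An orthogonal map that carries the direction of \<open>e\<close> to that of
    \<open>x0\<close>; this reduces everything to stretching along \<open>e\<close>.\<close>
  then obtain R where R: "orthogonal_transformation R" "R (a *\<^sub>R e) = x0"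
    using orthogonal_transformation_exists by blast
  define S where "S = inv R"
  have S: "orthogonal_transformation S" unfolding S_def by (rule orthogonal_transformation_inv[OF R(1)])
  have RS: "R (S x) = x" "S (R x) = x" for x
    unfolding S_def using orthogonal_transformation_bij[OF R(1)]
    by (simp_all add: bij_is_inj bij_is_surj surj_f_inv_f)
  have linR: "linear R" and linS: "linear S" using R S by (auto simp: orthogonal_transformation_def)
  have RSi: "R z \<bullet> \<xi> = z \<bullet> S \<xi>" for z \<xi>
    using R(1) RS(1)[of \<xi>] unfolding orthogonal_transformation_def by metis
  have ee: "e \<bullet> e = 1" using e by (simp add: dot_square_norm)
  \<comment> \<open>Scaling by \<open>b\<close> along \<open>e\<close> and by \<open>h\<close>
    orthogonally to it: symmetric, with inverse \<open>D (1 / h) (1 / b)\<close>, and with norm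
    given by Pythagoras. The required map is \<open>D h a\<close> followed by \<open>R\<close>, and
    its adjoint is \<open>S\<close> followed by \<open>D h a\<close>.\<close>
  define D where "D h b z = h *\<^sub>R z + ((b - h) * (z \<bullet> e)) *\<^sub>R e" for h b :: real and z :: "real^'n"
  have linD: "linear (D h b)" for h b
    by (rule linearI) (auto simp: D_def algebra_simps inner_add_left)
  have De: "D h b z \<bullet> e = b * (z \<bullet> e)" for h b z
    using ee by (simp add: D_def inner_add_left algebra_simps)
  have DD: "D (1 / h) (1 / b) (D h b z) = z" if "h > 0" "b > 0" for h b z
  proof -
    have "D (1 / h) (1 / b) (D h b z) = z + (((b - h) * (z \<bullet> e)) / h + (1 / b - 1 / h) * (b * (z \<bullet> e))) *\<^sub>R e"
      using that unfolding D_def[of "1/h"] De by (simp add: D_def scaleR_add_right scaleR_add_left)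
    also have "((b - h) * (z \<bullet> e)) / h + (1 / b - 1 / h) * (b * (z \<bullet> e)) = 0"
      using that by (simp add: field_simps)
    finally show ?thesis by simp
  qed
  have DD': "D h b (D (1 / h) (1 / b) z) = z" if "h > 0" "b > 0" for h b z
    using DD[of "1/h" "1/b" z] that by simp
  have nD: "(norm (D h b z))\<^sup>2 = h\<^sup>2 * ((norm z)\<^sup>2 - (z \<bullet> e)\<^sup>2) + b\<^sup>2 * (z \<bullet> e)\<^sup>2" for h b z
  proof -
    have "(norm (D h b z))\<^sup>2 = D h b z \<bullet> D h b z" by (simp add: dot_square_norm)
    also have "\<dots> = h * (D h b z \<bullet> z) + (b - h) * (z \<bullet> e) * (D h b z \<bullet> e)"
      by (subst (2) D_def) (simp add: inner_add_right)
    also have "D h b z \<bullet> z = h * (norm z)\<^sup>2 + (b - h) * (z \<bullet> e)\<^sup>2"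
      by (simp add: D_def inner_add_left inner_add_right inner_commute dot_square_norm power2_eq_square)
    finally show ?thesis unfolding De by (simp add: algebra_simps power2_eq_square)
  qed
  have Dsym: "D h b z \<bullet> y = z \<bullet> D h b y" for h b z y
    by (simp add: D_def inner_add_left inner_add_right inner_commute)
  have nR: "norm (R z) = norm z" "norm (S z) = norm z" for z
    using R S by (simp_all add: orthogonal_transformation_norm)
  show thesis
  proof (rule that[of "\<lambda>h. R \<circ> D h a" "\<lambda>h. D (1 / h) (1 / a) \<circ> S" "\<lambda>h. D h a \<circ> S"])
    fix h :: real assume h: "h > 0"
    show "linear (R \<circ> D h a)" "linear (D (1 / h) (1 / a) \<circ> S)" "linear (D h a \<circ> S)"
      by (intro linear_compose linD linR linS)+
    show "(R \<circ> D h a) ((D (1 / h) (1 / a) \<circ> S) x) = x" "(D (1 / h) (1 / a) \<circ> S) ((R \<circ> D h a) x) = x" for x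
      using h a by (simp_all add: RS DD DD')
    show "(R \<circ> D h a) z \<bullet> \<xi> = z \<bullet> (D h a \<circ> S) \<xi>" for z \<xi>
      by (simp add: RSi Dsym)
    show "(norm ((R \<circ> D h a) z))\<^sup>2 = h\<^sup>2 * ((norm z)\<^sup>2 - (z \<bullet> e)\<^sup>2) + (norm x0)\<^sup>2 * (z \<bullet> e)\<^sup>2" for z
      by (simp add: nR nD a_def)
    show "(norm ((D h a \<circ> S) \<xi>))\<^sup>2 = h\<^sup>2 * ((norm \<xi>)\<^sup>2 - (\<xi> \<bullet> x0)\<^sup>2 / (norm x0)\<^sup>2) + (\<xi> \<bullet> x0)\<^sup>2" for \<xi>
    proof -
      have "a * (S \<xi> \<bullet> e) = \<xi> \<bullet> x0"
        using RSi[of "a *\<^sub>R e" \<xi>] R(2) by (simp add: inner_commute)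
      then have "S \<xi> \<bullet> e = (\<xi> \<bullet> x0) / a" using a by (simp add: field_simps)
      then show ?thesis using a by (simp add: nD nR a_def power_divide)
    qed
    show "norm ((R \<circ> D h a) z - (z \<bullet> e) *\<^sub>R x0) \<le> 2 * h * norm z" for z
    proof -
      have "(R \<circ> D h a) z - (z \<bullet> e) *\<^sub>R x0 = R (D h a z - (z \<bullet> e) *\<^sub>R (a *\<^sub>R e))"
        by (simp only: o_apply linear_diff[OF linR] linear_scale[OF linR, of "z \<bullet> e" "a *\<^sub>R e"] R(2))
      also have "D h a z - (z \<bullet> e) *\<^sub>R (a *\<^sub>R e) = h *\<^sub>R (z - (z \<bullet> e) *\<^sub>R e)"
        by (simp add: D_def algebra_simps)
      finally have "norm ((R \<circ> D h a) z - (z \<bullet> e) *\<^sub>R x0) = h * norm (z - (z \<bullet> e) *\<^sub>R e)"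
        using h by (simp add: nR)
      also have "norm (z - (z \<bullet> e) *\<^sub>R e) \<le> norm z + \<bar>z \<bullet> e\<bar> * norm e"
        using norm_triangle_ineq4[of z "(z \<bullet> e) *\<^sub>R e"] by simp
      also have "\<dots> \<le> 2 * norm z" using Cauchy_Schwarz_ineq2[of z e] e by simp
      finally show ?thesis using h by simp
    qed
  qed
qed

section \<open>The limit p \<rightarrow> 0\<close>

locale gauge =
  fixes N :: "real^'n \<Rightarrow> real" and c C :: real
  assumes c_pos: "0 < c" and C_pos: "0 < C"
    and lower: "c * norm x \<le> N x" and upper: "N x \<le> C * norm x"
    and hom: "N (t *\<^sub>R x) = \<bar>t\<bar> * N x"
    and cont: "continuous_on (- {0}) N"
begin

lemma measurable_N [measurable]: "N \<in> borel_measurable borel"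
  by (rule borel_measurable_continuous_countable_exceptions[of "{0}"]) (use cont in auto)

lemma pos: "x \<noteq> 0 \<Longrightarrow> 0 < N x"
proof -
  assume "x \<noteq> 0"
  then have "0 < c * norm x" using c_pos by simp
  with lower[of x] show "0 < N x" by linarith
qed

text \<open>Dominates both \<open>(N\<^sup>-\<^sup>p - 1) / p\<close> and \<open>ln N\<close> at \<open>W z\<close>, uniformly in \<open>p \<le> 1/4\<close> and in the
  linear maps \<open>W\<close> with \<open>m |(z, e)| \<le> |W z| \<le> M |z|\<close>.\<close>

definition majorant :: "real \<Rightarrow> real \<Rightarrow> real^'n \<Rightarrow> real^'n \<Rightarrow> real" where
  "majorant m M e z = 4 * (sqrt (C * M) * (1 + norm z) + inverse (sqrt (c * m)) * inverse (sqrt \<bar>z \<bullet> e\<bar>))"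

text \<open>The gauge at \<open>y\<close> lies between c m |(z, e)| and C M |z|. The square root of
  |z| is enlarged to 1 + |z| so that a first Gaussian moment suffices.\<close>

lemma majorant_bound:
  assumes "m > 0" "z \<bullet> e \<noteq> 0" "m * \<bar>z \<bullet> e\<bar> \<le> norm y" "norm y \<le> M * norm z"
  shows "y \<noteq> 0" "4 * (sqrt (N y) + inverse (sqrt (N y))) \<le> majorant m M e z"
proof -
  have p: "0 < m * \<bar>z \<bullet> e\<bar>" using assms by simp
  with assms(3) show "y \<noteq> 0" by auto
  have "0 < norm y" using p assms(3) by linarith
  then have "0 < M * norm z" using assms(4) by linarith
  then have M: "0 < M" by (simp add: zero_less_mult_iff)
  have "N y \<le> C * M * norm z"
    using order_trans[OF upper[of y] mult_left_mono[OF assms(4), of C]] C_pos by (simp add: mult.assoc)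
  then have "sqrt (N y) \<le> sqrt (C * M) * sqrt (norm z)"
    by (simp add: real_sqrt_mult[symmetric])
  also have "\<dots> \<le> sqrt (C * M) * (1 + norm z)"
  proof (intro mult_left_mono)
    have "norm z \<le> (1 + norm z)\<^sup>2" by (simp add: power2_eq_square algebra_simps)
    then show "sqrt (norm z) \<le> 1 + norm z" by (intro real_le_lsqrt) auto
  qed (use C_pos M in auto)
  finally have 1: "sqrt (N y) \<le> sqrt (C * M) * (1 + norm z)" .
  have "c * m * \<bar>z \<bullet> e\<bar> \<le> N y"
    using order_trans[OF mult_left_mono[OF assms(3), of c] lower[of y]] c_pos by (simp add: mult.assoc)
  then have "sqrt (c * m) * sqrt \<bar>z \<bullet> e\<bar> \<le> sqrt (N y)"
    by (simp add: real_sqrt_mult[symmetric])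
  moreover have "0 < sqrt (c * m) * sqrt \<bar>z \<bullet> e\<bar>" using c_pos assms by simp
  ultimately have "inverse (sqrt (N y)) \<le> inverse (sqrt (c * m) * sqrt \<bar>z \<bullet> e\<bar>)"
    by (rule le_imp_inverse_le)
  with 1 show "4 * (sqrt (N y) + inverse (sqrt (N y))) \<le> majorant m M e z"
    by (simp add: majorant_def)
qed

text \<open>With \<open>e\<close> in \<open>Basis\<close> the inner product is a coordinate, so the
  singular term reduces to one dimension.\<close>

lemma integrable_majorant:
  assumes e: "e \<in> Basis"
  shows "integrable gauss_measure (majorant m M e)"
proof -
  interpret prob_space "gauss_measure :: (real^'n) measure" by (rule prob_space_gauss_measure)
  have 1: "integrable gauss_measure (norm :: real^'n \<Rightarrow> real)"
    by (intro integrable_gauss_measure gauss_density_integrable_norm) auto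
  have 2: "integrable gauss_measure (\<lambda>z::real^'n. inverse (sqrt \<bar>z \<bullet> e\<bar>))"
    by (intro integrable_gauss_measure
        gauss_density_integrable_coord[OF e, of "\<lambda>t. inverse (sqrt \<bar>t\<bar>)"] integrable_inverse_sqrt_std_normal) auto
  show ?thesis unfolding majorant_def
    by (intro Bochner_Integration.integrable_mult_right Bochner_Integration.integrable_add 1 2) auto
qed

text \<open>Both facts rest on the domination by \<open>majorant\<close>. The first one is the
  derivative of E N(W Z)^(-p) at p = 0, taken under the integral along a sequence.\<close>

lemma
  fixes p :: "nat \<Rightarrow> real" and W :: "real^'n \<Rightarrow> real^'n" and e :: "real^'n"
  assumes W [measurable]: "W \<in> borel_measurable borel" and e: "e \<in> Basis" and m: "m > 0"
    and WB: "\<And>z. m * \<bar>z \<bullet> e\<bar> \<le> norm (W z)" "\<And>z. norm (W z) \<le> M * norm z"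
  shows tendsto_quotient: "p \<longlonglongrightarrow> 0 \<Longrightarrow> (\<And>k. 0 < p k) \<Longrightarrow> (\<And>k. p k \<le> 1/4) \<Longrightarrow>
      (\<lambda>k. ((\<integral>z. N (W z) powr (- p k) \<partial>gauss_measure) - 1) / p k)
        \<longlonglongrightarrow> - (\<integral>z. ln (N (W z)) \<partial>gauss_measure)"
    and powr_integral_pos: "\<And>q. 0 < q \<Longrightarrow> q \<le> 1/4 \<Longrightarrow> 0 < (\<integral>z. N (W z) powr (- q) \<partial>gauss_measure)"
proof -
  interpret prob_space "gauss_measure :: (real^'n) measure" by (rule prob_space_gauss_measure)
  have AE: "AE z in gauss_measure. z \<bullet> e \<noteq> 0" using e by (intro AE_gauss_coordinate_neq_0) auto
  have b: "AE z in gauss_measure. norm ((N (W z) powr (- q) - 1) / q) \<le> majorant m M e z"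
    if q: "0 < q" "q \<le> 1/4" for q
    using AE
  proof eventually_elim
    case (elim z)
    note d = majorant_bound[OF m elim WB]
    show ?case using powr_diff_quotient_bound(1)[OF pos[OF d(1)] q] d(2) by simp
  qed
  have iq: "integrable gauss_measure (\<lambda>z. (N (W z) powr (- q) - 1) / q)"
    if q: "0 < q" "q \<le> 1/4" for q
  proof (rule Bochner_Integration.integrable_bound[OF integrable_majorant[OF e, of m M]])
    show "AE z in gauss_measure. norm ((N (W z) powr (- q) - 1) / q) \<le> norm (majorant m M e z)"
      using b[OF q] by eventually_elim simp
  qed simp
  \<comment> \<open>Integrability of the power is recovered from that of its difference
    quotient.\<close>
  have i: "integrable gauss_measure (\<lambda>z. N (W z) powr (- q))" if q: "0 < q" "q \<le> 1/4" for q
  proof -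
    have "integrable gauss_measure (\<lambda>z. q * ((N (W z) powr (- q) - 1) / q) + 1)"
      by (intro Bochner_Integration.integrable_add Bochner_Integration.integrable_mult_right iq q) simp
    then show ?thesis using q by simp
  qed
  show "0 < (\<integral>z. N (W z) powr (- q) \<partial>gauss_measure)" if q: "0 < q" "q \<le> 1/4" for q
  proof -
    have "\<not> (AE z in gauss_measure. N (W z) powr (- q) = 0)"
    proof
      assume "AE z in gauss_measure. N (W z) powr (- q) = 0"
      with AE have "AE z::real^'n in gauss_measure. False"
      proof eventually_elim
        case (elim z)
        then show ?case using pos[OF majorant_bound(1)[OF m elim(1) WB]] by simp
      qed
      then show False by simp
    qed
    moreover have "0 \<le> (\<integral>z. N (W z) powr (- q) \<partial>gauss_measure)" by simp
    ultimately show ?thesis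
      using integral_nonneg_eq_0_iff_AE[OF i[OF q]] by (simp add: less_le)
  qed
  assume p: "p \<longlonglongrightarrow> 0" "\<And>k. 0 < p k" "\<And>k. p k \<le> 1/4"
  have "(\<lambda>k. \<integral>z. (N (W z) powr (- p k) - 1) / p k \<partial>gauss_measure)
      \<longlonglongrightarrow> (\<integral>z. - ln (N (W z)) \<partial>gauss_measure)"
  proof (rule integral_dominated_convergence[where w = "majorant m M e"])
    show "AE z in gauss_measure. (\<lambda>k. (N (W z) powr (- p k) - 1) / p k) \<longlonglongrightarrow> - ln (N (W z))"
      using AE
    proof eventually_elim
      case (elim z)
      show ?case using pos[OF majorant_bound(1)[OF m elim WB]] p by (intro powr_diff_quotient_tendsto)
    qed
    show "AE z in gauss_measure. norm ((N (W z) powr (- p k) - 1) / p k) \<le> majorant m M e z" for k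
      by (rule b[OF p(2,3)])
  qed (use integrable_majorant[OF e] in auto)
  moreover have "(\<integral>z. (N (W z) powr (- p k) - 1) / p k \<partial>gauss_measure)
      = ((\<integral>z. N (W z) powr (- p k) \<partial>gauss_measure) - 1) / p k" for k
    using i[OF p(2,3)] prob_space by simp
  ultimately show "(\<lambda>k. ((\<integral>z. N (W z) powr (- p k) \<partial>gauss_measure) - 1) / p k)
        \<longlonglongrightarrow> - (\<integral>z. ln (N (W z)) \<partial>gauss_measure)"
    by (simp only: Bochner_Integration.integral_minus)
qed

text \<open>The lower bound m |(z, e)| survives the passage to the rank one limit, so one majorant
  serves all \<open>j\<close>. Homogeneity splits the logarithm of the limit into ln N(x0) + ln |(z,
  e)|.\<close>

lemma tendsto_log_integral:
  fixes W :: "nat \<Rightarrow> real^'n \<Rightarrow> real^'n"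
  assumes W [measurable]: "\<And>j. W j \<in> borel_measurable borel" and e: "e \<in> Basis" and m: "m > 0"
    and WB: "\<And>j z. m * \<bar>z \<bullet> e\<bar> \<le> norm (W j z)" "\<And>j z. norm (W j z) \<le> M * norm z"
    and x0: "x0 \<noteq> 0" and lim: "\<And>z. (\<lambda>j. W j z) \<longlonglongrightarrow> (z \<bullet> e) *\<^sub>R x0"
  shows "(\<lambda>j. \<integral>z. ln (N (W j z)) \<partial>gauss_measure)
    \<longlonglongrightarrow> ln (N x0) + (\<integral>z. ln \<bar>z \<bullet> e\<bar> \<partial>gauss_measure)"
proof -
  interpret prob_space "gauss_measure :: (real^'n) measure" by (rule prob_space_gauss_measure)
  have AE: "AE z in gauss_measure. z \<bullet> e \<noteq> 0" using e by (intro AE_gauss_coordinate_neq_0) auto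
  let ?f = "\<lambda>z. ln (N ((z \<bullet> e) *\<^sub>R x0))"
  have m1: "?f \<in> borel_measurable gauss_measure" and m2: "(\<lambda>z. ln (N (W j z))) \<in> borel_measurable gauss_measure" for j
    by measurable
  have lim': "AE z in gauss_measure. (\<lambda>j. ln (N (W j z))) \<longlonglongrightarrow> ?f z"
    using AE
  proof eventually_elim
    case (elim z)
    then have nz: "(z \<bullet> e) *\<^sub>R x0 \<noteq> 0" using x0 by simp
    then have "isCont N ((z \<bullet> e) *\<^sub>R x0)"
      using cont by (simp add: continuous_on_eq_continuous_at open_Compl)
    then have "(\<lambda>j. N (W j z)) \<longlonglongrightarrow> N ((z \<bullet> e) *\<^sub>R x0)"
      using lim by (rule isCont_tendsto_compose)
    then show ?case using pos[OF nz] by (intro tendsto_ln) auto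
  qed
  have bd: "AE z in gauss_measure. norm (ln (N (W j z))) \<le> majorant m M e z" for j
    using AE
  proof eventually_elim
    case (elim z)
    note d = majorant_bound[OF m elim WB]
    show ?case using powr_diff_quotient_bound(2)[OF pos[OF d(1)[of j]], of "1/4"] d(2)[of j] by simp
  qed
  have L: "(\<lambda>j. \<integral>z. ln (N (W j z)) \<partial>gauss_measure) \<longlonglongrightarrow> integral\<^sup>L gauss_measure ?f"
    by (rule integral_dominated_convergence[OF m1 m2 integrable_majorant[OF e] lim' bd])
  have I: "integrable gauss_measure ?f"
    by (rule integrable_dominated_convergence[OF m1 m2 integrable_majorant[OF e] lim' bd])
  have eq: "AE z in gauss_measure. ?f z = ln (N x0) + ln \<bar>z \<bullet> e\<bar>"
    using AE by eventually_elim (use pos[OF x0] in \<open>simp add: hom ln_mult\<close>)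
  have "integrable gauss_measure (\<lambda>z. ?f z - ln (N x0))"
    by (intro Bochner_Integration.integrable_diff I) simp
  \<comment> \<open>The integrability of ln |(z, e)| is inherited from the dominated limit, from
    which it differs by a constant.\<close>
  then have I': "integrable gauss_measure (\<lambda>z. ln \<bar>z \<bullet> e\<bar>)"
    by (rule integrable_cong_AE_imp) (use eq in \<open>auto elim!: eventually_mono\<close>)
  have "integral\<^sup>L gauss_measure ?f = (\<integral>z. ln (N x0) + ln \<bar>z \<bullet> e\<bar> \<partial>gauss_measure)"
    by (rule integral_cong_AE) (use eq in auto)
  also have "\<dots> = ln (N x0) + (\<integral>z. ln \<bar>z \<bullet> e\<bar> \<partial>gauss_measure)"
    using I' prob_space by simp
  finally show ?thesis using L by simp
qed

end

section \<open>Weak limits of the normalised measures\<close>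

lemma integrable_continuous_on_compact:
  fixes f :: "'a::euclidean_space \<Rightarrow> real"
  assumes S: "compact S" and P: "prob_space P" "sets P = sets (restrict_space borel S)"
    and f: "continuous_on S f"
  shows "integrable P f"
proof -
  interpret prob_space P by (rule P)
  have space: "space P = S"
    using sets_eq_imp_space_eq[OF P(2)] by (simp add: space_restrict_space)
  have "bounded (f ` S)" by (intro compact_imp_bounded compact_continuous_image f S)
  then obtain D where "\<And>x. x \<in> S \<Longrightarrow> \<bar>f x\<bar> \<le> D" unfolding bounded_pos by auto
  moreover have "f \<in> borel_measurable P"
    using borel_measurable_continuous_on_restrict[OF f] measurable_cong_sets[OF P(2) refl] by blast
  ultimately show ?thesis by (intro integrable_const_bound[of _ D]) (auto simp: space)
qed

text \<open>Exponent and measure vary together. As \<open>L\<close> is bounded on \<open>S\<close>,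
  the difference quotient is - L + O(p) uniformly on \<open>S\<close>, so the changing measure
  enters only through the integral of \<open>L\<close>.\<close>

lemma quotient_integral_tendsto:
  fixes L :: "'a::euclidean_space \<Rightarrow> real" and p :: "nat \<Rightarrow> real"
  assumes S: "compact S"
    and P: "\<And>k. prob_space (P k)" "\<And>k. sets (P k) = sets (restrict_space borel S)"
    and weak: "(\<lambda>k. \<integral>x. L x \<partial>P k) \<longlonglongrightarrow> l"
    and L: "continuous_on S L" and p: "p \<longlonglongrightarrow> 0" "\<And>k. p k > 0"
  shows "(\<lambda>k. ((\<integral>x. exp (- p k * L x) \<partial>P k) - 1) / p k) \<longlonglongrightarrow> - l"
proof -
  have "bounded (L ` S)" by (intro compact_imp_bounded compact_continuous_image L S)
  then obtain B where B: "B > 0" "\<And>x. x \<in> S \<Longrightarrow> \<bar>L x\<bar> \<le> B"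
    unfolding bounded_pos by auto
  have space: "space (P k) = S" for k
    using sets_eq_imp_space_eq[OF P(2)] by (simp add: space_restrict_space)
  have int: "integrable (P k) f" if "continuous_on S f" for f :: "'a \<Rightarrow> real" and k
    by (rule integrable_continuous_on_compact[OF S P that])
  have "\<forall>\<^sub>F k in sequentially. p k < 1 / B"
    using order_tendstoD(2)[OF p(1), of "1 / B"] B by simp
  then have ev: "\<forall>\<^sub>F k in sequentially.
      norm (((\<integral>x. exp (- p k * L x) \<partial>P k) - 1) / p k + (\<integral>x. L x \<partial>P k)) \<le> p k * B\<^sup>2"
  proof eventually_elim
    case (elim k)
    interpret prob_space "P k" by (rule P)
    let ?h = "\<lambda>x. (exp (- p k * L x) - 1) / p k + L x"
    have i: "integrable (P k) (\<lambda>x. exp (- p k * L x))" "integrable (P k) L"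
      by (intro int continuous_intros L)+
    have hb: "\<bar>?h x\<bar> \<le> p k * B\<^sup>2" if "x \<in> S" for x
    proof -
      have "\<bar>- p k * L x\<bar> \<le> p k * B" using B(2)[OF that] p(2)[of k] by (simp add: abs_mult mult_left_mono)
      moreover have "p k * B \<le> 1" using elim B by (simp add: field_simps)
      ultimately have "\<bar>exp (- p k * L x) - 1 - (- p k * L x)\<bar> \<le> (- p k * L x)\<^sup>2"
        by (intro exp_minus_one_minus_bound) linarith
      also have "\<dots> = (p k)\<^sup>2 * \<bar>L x\<bar>\<^sup>2" by (simp add: power_mult_distrib)
      also have "\<dots> \<le> (p k)\<^sup>2 * B\<^sup>2" by (intro mult_left_mono power_mono B that) auto
      finally have le: "\<bar>exp (- p k * L x) - 1 - (- p k * L x)\<bar> \<le> p k * (p k * B\<^sup>2)"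
        by (simp add: power2_eq_square mult_ac)
      have "?h x = (exp (- p k * L x) - 1 - (- p k * L x)) / p k" using p(2)[of k] by (simp add: field_simps)
      then have "\<bar>?h x\<bar> = \<bar>exp (- p k * L x) - 1 - (- p k * L x)\<bar> / p k" using p(2)[of k] by (simp add: abs_divide)
      also have "\<dots> \<le> p k * B\<^sup>2" using le p(2)[of k] by (simp add: divide_le_eq mult.commute)
      finally show ?thesis .
    qed
    have ih: "integrable (P k) ?h"
      by (intro Bochner_Integration.integrable_add Bochner_Integration.integrable_divide
          Bochner_Integration.integrable_diff i) simp
    have "(\<integral>x. ?h x \<partial>P k) \<le> p k * B\<^sup>2" "- (p k * B\<^sup>2) \<le> (\<integral>x. ?h x \<partial>P k)"
      using hb by (intro integral_le_const integral_ge_const ih AE_I2; force simp: space abs_le_iff)+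
    moreover have "(\<integral>x. ?h x \<partial>P k) = ((\<integral>x. exp (- p k * L x) \<partial>P k) - 1) / p k + (\<integral>x. L x \<partial>P k)"
      using i prob_space by simp
    ultimately show ?case by (simp add: abs_le_iff)
  qed
  have "(\<lambda>k. p k * B\<^sup>2) \<longlonglongrightarrow> 0" using tendsto_mult_left_zero[OF p(1)] by simp
  from Lim_null_comparison[OF ev this]
  have "(\<lambda>k. ((\<integral>x. exp (- p k * L x) \<partial>P k) - 1) / p k + (\<integral>x. L x \<partial>P k)) \<longlonglongrightarrow> 0" .
  from tendsto_diff[OF this weak] show ?thesis by simp
qed

text \<open>Equality almost everywhere is the useful form: the extended logarithm may still be
  -\<infinity> on a null set.\<close>

lemma ext_integral_eq_integral:
  assumes g: "integrable M g" and eq: "AE x in M. f x = ereal (g x)"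
  shows "ext_integral M f = ereal (integral\<^sup>L M g)"
proof -
  have "(\<integral>\<^sup>+ x. e2ennreal (f x) \<partial>M) = (\<integral>\<^sup>+ x. ennreal (g x) \<partial>M)"
    by (rule nn_integral_cong_AE) (use eq in eventually_elim, simp add: ennreal.abs_eq)
  moreover have "(\<integral>\<^sup>+ x. e2ennreal (- f x) \<partial>M) = (\<integral>\<^sup>+ x. ennreal (- g x) \<partial>M)"
    by (rule nn_integral_cong_AE) (use eq in eventually_elim, simp)
  moreover have "(\<integral>\<^sup>+ x. ennreal (g x) \<partial>M) < \<infinity>" "(\<integral>\<^sup>+ x. ennreal (- g x) \<partial>M) < \<infinity>"
    using real_integrable_def g by (auto simp: less_top)
  ultimately show ?thesis
    unfolding ext_integral_def real_lebesgue_integral_def[OF g]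
    by (cases "\<integral>\<^sup>+ x. ennreal (g x) \<partial>M" rule: ennreal_cases;
        cases "\<integral>\<^sup>+ x. ennreal (- g x) \<partial>M" rule: ennreal_cases) (simp_all add: enn2ereal_ennreal)
qed

context gauge
begin

text \<open>For \<open>W\<close> the identity the integrand on the sphere is 1, so E N(Z)^(-p) is
  \<open>\<kappa>\<close> times the total mass. This eliminates \<open>\<kappa>\<close> once the
  measure is divided by its mass.\<close>

lemma normalized_embedding:
  assumes p: "0 < p" "p \<le> 1/4" and emb: "\<exists>\<mu>::(real^'n) measure. finite_sphere_measure \<mu> \<and>
      (\<forall>\<phi>. schwartz_function \<phi> \<longrightarrow> (LINT x|lborel. (N x powr (-p)) *\<^sub>R \<phi> x) =
        (LINT \<xi>|\<mu>. (LINT t|lborel. (\<bar>t\<bar> powr (p - 1)) *\<^sub>R fourier_transform \<phi> (t *\<^sub>R \<xi>))))"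
  obtains P :: "(real^'n) measure" where "prob_space P" "sets P = sets (restrict_space borel (sphere 0 1))"
    "\<And>(W :: real^'n \<Rightarrow> real^'n) V W'. linear W \<Longrightarrow> linear V \<Longrightarrow> linear W' \<Longrightarrow> (\<And>x. W (V x) = x) \<Longrightarrow> (\<And>x. V (W x) = x) \<Longrightarrow>
      (\<And>z \<xi>. W z \<bullet> \<xi> = z \<bullet> W' \<xi>) \<Longrightarrow>
      (\<integral>z. N (W z) powr (-p) \<partial>gauss_measure)
        = (\<integral>z. N z powr (-p) \<partial>gauss_measure) * (\<integral>\<xi>. norm (W' \<xi>) powr (-p) \<partial>P)"
proof -
  obtain \<mu> :: "(real^'n) measure" where \<mu>: "finite_measure \<mu>" "sets \<mu> = sets (restrict_space borel (sphere 0 1))"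
    "\<And>\<phi>. schwartz_function \<phi> \<Longrightarrow> (LINT x|lborel. (N x powr (-p)) *\<^sub>R \<phi> x) =
        (LINT \<xi>|\<mu>. (LINT t|lborel. (\<bar>t\<bar> powr (p - 1)) *\<^sub>R fourier_transform \<phi> (t *\<^sub>R \<xi>)))"
    using emb unfolding finite_sphere_measure_def by auto
  interpret \<mu>: finite_measure \<mu> by fact
  have space: "space \<mu> = sphere 0 1"
    using sets_eq_imp_space_eq[OF \<mu>(2)] by (simp add: space_restrict_space)
  define \<kappa> where "\<kappa> = (\<integral>t. \<bar>t\<bar> powr (p - 1) * exp (- t\<^sup>2 / 2) \<partial>lborel)"
  have E: "(\<integral>z. N (W z) powr (-p) \<partial>gauss_measure) = \<kappa> * (\<integral>\<xi>. norm (W' \<xi>) powr (-p) \<partial>\<mu>)"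
    if "linear W" "linear V" "linear W'" "\<And>x. W (V x) = x" "\<And>x. V (W x) = x"
      "\<And>z \<xi>. W z \<bullet> \<xi> = z \<bullet> W' \<xi>" for W V W' :: "real^'n \<Rightarrow> real^'n"
    unfolding \<kappa>_def by (rule embedding_gaussian[OF measurable_N \<mu>(2) _ that]) (rule \<mu>(3))
  have "(\<integral>z. N z powr (-p) \<partial>gauss_measure) = \<kappa> * (\<integral>\<xi>. norm \<xi> powr (-p) \<partial>\<mu>)"
    using E[of "\<lambda>x. x" "\<lambda>x. x" "\<lambda>x. x"] linear_ident by simp
  also have "(\<integral>\<xi>. norm \<xi> powr (-p) \<partial>\<mu>) = (\<integral>\<xi>. 1 \<partial>\<mu>)"
    by (intro Bochner_Integration.integral_cong) (auto simp: space)
  finally have tot: "(\<integral>z. N z powr (-p) \<partial>gauss_measure) = \<kappa> * measure \<mu> (space \<mu>)" by simp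
  obtain e :: "real^'n" where e: "e \<in> Basis" using nonempty_Basis by blast
  \<comment> \<open>Positivity of the left side forces the total mass to be nonzero without any
    evaluation of \<open>\<kappa>\<close>.\<close>
  have "0 < (\<integral>z. N z powr (-p) \<partial>gauss_measure)"
    using powr_integral_pos[of "\<lambda>z. z" e 1 1 p] e p Basis_le_norm[OF e] by simp
  then have M: "measure \<mu> (space \<mu>) > 0"
    using tot by (metis less_irrefl mult_zero_right zero_less_measure_iff)
  define M where "M = measure \<mu> (space \<mu>)"
  have M0: "M > 0" using M by (simp add: M_def)
  define P where "P = density \<mu> (\<lambda>_. ennreal (1 / M))"
  have int: "(\<integral>\<xi>. f \<xi> \<partial>P) = (\<integral>\<xi>. f \<xi> \<partial>\<mu>) / M" if "f \<in> borel_measurable \<mu>" for f :: "real^'n \<Rightarrow> real"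
    unfolding P_def using that M0 by (subst integral_density) auto
  show thesis
  proof (rule that[of P])
    show "prob_space P"
    proof
      have "emeasure P (space P) = ennreal (1 / M) * emeasure \<mu> (space \<mu>)"
        unfolding P_def by (subst emeasure_density_const) auto
      also have "\<dots> = ennreal (1 / M * M)"
        unfolding \<mu>.emeasure_eq_measure M_def[symmetric] using M0 by (simp add: ennreal_mult[symmetric])
      also have "\<dots> = 1" using M0 by simp
      finally show "emeasure P (space P) = 1" .
    qed
    show "sets P = sets (restrict_space borel (sphere 0 1))" by (simp add: P_def \<mu>(2))
    fix W V W' :: "real^'n \<Rightarrow> real^'n"
    assume lin: "linear W" "linear V" "linear W'" and *: "\<And>x. W (V x) = x" "\<And>x. V (W x) = x"
      "\<And>z \<xi>. W z \<bullet> \<xi> = z \<bullet> W' \<xi>"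
    have [measurable]: "W' \<in> borel_measurable borel" by (rule linear_borel_measurable[OF lin(3)])
    have "(\<lambda>\<xi>. norm (W' \<xi>) powr (-p)) \<in> borel_measurable (restrict_space borel (sphere 0 1))"
      by (rule measurable_restrict_space1) measurable
    then have "(\<lambda>\<xi>. norm (W' \<xi>) powr (-p)) \<in> borel_measurable \<mu>"
      using measurable_cong_sets[OF \<mu>(2) refl] by blast
    from int[OF this] show "(\<integral>z. N (W z) powr (-p) \<partial>gauss_measure)
        = (\<integral>z. N z powr (-p) \<partial>gauss_measure) * (\<integral>\<xi>. norm (W' \<xi>) powr (-p) \<partial>P)"
      unfolding E[OF lin *] tot M_def[symmetric] using M0 by simp
  qed
qed

text \<open>Weak convergence concerns all continuous functions at once, so a single subsequence and
  a single limit measure serve every \<open>W\<close>; the later degeneration of \<open>W\<close>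
  depends on this.\<close>

lemma limit_measure:
  assumes \<epsilon>: "0 < \<epsilon>" and emb: "\<And>p. 0 < p \<Longrightarrow> p < \<epsilon> \<Longrightarrow> \<exists>\<mu>::(real^'n) measure. finite_sphere_measure \<mu> \<and>
      (\<forall>\<phi>. schwartz_function \<phi> \<longrightarrow> (LINT x|lborel. (N x powr (-p)) *\<^sub>R \<phi> x) =
        (LINT \<xi>|\<mu>. (LINT t|lborel. (\<bar>t\<bar> powr (p - 1)) *\<^sub>R fourier_transform \<phi> (t *\<^sub>R \<xi>))))"
  obtains \<nu> :: "(real^'n) measure" where "prob_space \<nu>" "sets \<nu> = sets (restrict_space borel (sphere 0 1))"
    "\<And>(W :: real^'n \<Rightarrow> real^'n) V W'. linear W \<Longrightarrow> linear V \<Longrightarrow> linear W' \<Longrightarrow> (\<And>x. W (V x) = x) \<Longrightarrow> (\<And>x. V (W x) = x) \<Longrightarrow>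
      (\<And>z \<xi>. W z \<bullet> \<xi> = z \<bullet> W' \<xi>) \<Longrightarrow>
      (\<integral>z. ln (N (W z)) \<partial>gauss_measure) = (\<integral>z. ln (N z) \<partial>gauss_measure) + (\<integral>\<xi>. ln (norm (W' \<xi>)) \<partial>\<nu>)"
proof -
  \<comment> \<open>The denominator starts at 2 to keep \<open>p 0\<close> strictly below
    \<epsilon>; the bound 1/4 is that of \<open>powr_diff_quotient_bound\<close>.\<close>
  define p where "p k = min \<epsilon> (1/4) / real (k + 2)" for k
  have p0: "0 < p k" for k using \<epsilon> by (simp add: p_def)
  have p1: "p k \<le> 1/4" "p k < \<epsilon>" for k
  proof -
    have "min \<epsilon> (1/4) / real (k + 2) \<le> min \<epsilon> (1/4) / 2" using \<epsilon> by (intro divide_left_mono) auto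
    moreover have "min \<epsilon> (1/4) \<le> 1/4" "min \<epsilon> (1/4) \<le> \<epsilon>" by simp_all
    ultimately show "p k \<le> 1/4" "p k < \<epsilon>" using \<epsilon> unfolding p_def by linarith+
  qed
  have plim: "p \<longlonglongrightarrow> 0" unfolding p_def
    by (rule LIMSEQ_ignore_initial_segment[OF lim_const_over_n])
  define good where "good k P \<longleftrightarrow> prob_space P \<and> sets P = sets (restrict_space borel (sphere 0 1)) \<and>
    (\<forall>(W :: real^'n \<Rightarrow> real^'n) V W'. linear W \<longrightarrow> linear V \<longrightarrow> linear W' \<longrightarrow>
      (\<forall>x. W (V x) = x) \<longrightarrow> (\<forall>x. V (W x) = x) \<longrightarrow> (\<forall>z \<xi>. W z \<bullet> \<xi> = z \<bullet> W' \<xi>) \<longrightarrow>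
      (\<integral>z. N (W z) powr (- p k) \<partial>gauss_measure)
        = (\<integral>z. N z powr (- p k) \<partial>gauss_measure) * (\<integral>\<xi>. norm (W' \<xi>) powr (- p k) \<partial>P))"
    for k and P :: "(real^'n) measure"
  have "\<exists>P. good k P" for k
    unfolding good_def
    by (rule normalized_embedding[OF p0[of k] p1(1)[of k] emb[OF p0[of k] p1(2)[of k]]]) blast
  then obtain P where good: "\<And>k. good k (P k)" by metis
  have P: "prob_space (P k)" "sets (P k) = sets (restrict_space borel (sphere (0::real^'n) 1))"
    "\<And>(W :: real^'n \<Rightarrow> real^'n) V W'. linear W \<Longrightarrow> linear V \<Longrightarrow> linear W' \<Longrightarrow>
      (\<And>x. W (V x) = x) \<Longrightarrow> (\<And>x. V (W x) = x) \<Longrightarrow> (\<And>z \<xi>. W z \<bullet> \<xi> = z \<bullet> W' \<xi>) \<Longrightarrow>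
      (\<integral>z. N (W z) powr (- p k) \<partial>gauss_measure)
        = (\<integral>z. N z powr (- p k) \<partial>gauss_measure) * (\<integral>\<xi>. norm (W' \<xi>) powr (- p k) \<partial>P k)" for k
    using good[of k] unfolding good_def by blast+
  have S: "compact (sphere (0::real^'n) 1)" by simp
  show thesis
  proof (rule compact_prob_space_convergent_subsequence[where P = P, OF S P(1) P(2)])
    fix r :: "nat \<Rightarrow> nat" and \<nu> :: "(real^'n) measure"
    assume r: "strict_mono r" and \<nu>: "prob_space \<nu>" "sets \<nu> = sets (restrict_space borel (sphere (0::real^'n) 1))"
      "\<And>f::real^'n \<Rightarrow> real. continuous_on (sphere 0 1) f \<Longrightarrow> (\<lambda>k. \<integral>x. f x \<partial>P (r k)) \<longlonglongrightarrow> (\<integral>x. f x \<partial>\<nu>)"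
    obtain e :: "real^'n" where e: "e \<in> Basis" using nonempty_Basis by blast
    define q where "q k = p (r k)" for k
    have q: "0 < q k" "q k \<le> 1/4" "q \<longlonglongrightarrow> 0" for k
      using p0 p1 LIMSEQ_subseq_LIMSEQ[OF plim r] by (simp_all add: q_def[abs_def] comp_def)
    define E where "E W k = (\<integral>z. N (W z) powr (- q k) \<partial>gauss_measure)" for W :: "real^'n \<Rightarrow> real^'n" and k
    define A where "A W = (\<integral>z. ln (N (W z)) \<partial>gauss_measure)" for W :: "real^'n \<Rightarrow> real^'n"
    have lim_id: "(\<lambda>k. (E (\<lambda>z. z) k - 1) / q k) \<longlonglongrightarrow> - A (\<lambda>z. z)"
      unfolding E_def A_def
      by (rule tendsto_quotient[of "\<lambda>z. z" e 1 1]) (use e q Basis_le_norm[OF e] in auto)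
    \<comment> \<open>A bounded difference quotient times a vanishing step: the expectation for the
      identity tends to 1.\<close>
    have "(\<lambda>k. (E (\<lambda>z. z) k - 1) / q k * q k) \<longlonglongrightarrow> - A (\<lambda>z. z) * 0"
      by (intro tendsto_mult lim_id q)
    then have "(\<lambda>k. E (\<lambda>z. z) k - 1) \<longlonglongrightarrow> 0" 
      using q(1)[THEN less_imp_neq] by simp
    from tendsto_add[OF this tendsto_const[of 1]] have E1: "E (\<lambda>z. z) \<longlonglongrightarrow> 1" by simp
    show thesis
    proof (rule that[of \<nu>])
      fix W V W' :: "real^'n \<Rightarrow> real^'n"
      assume lin: "linear W" "linear V" "linear W'" and inv: "\<And>x. W (V x) = x" "\<And>x. V (W x) = x"
        and adj: "\<And>z \<xi>. W z \<bullet> \<xi> = z \<bullet> W' \<xi>"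
      have bl: "bounded_linear V" "bounded_linear W" using lin by (simp_all add: linear_linear)
      obtain m where m: "m > 0" "\<And>x. norm (V x) \<le> norm x * m"
        using bounded_linear.pos_bounded[OF bl(1)] by blast
      obtain M where M: "M > 0" "\<And>x. norm (W x) \<le> norm x * M"
        using bounded_linear.pos_bounded[OF bl(2)] by blast
      have lim_W: "(\<lambda>k. (E W k - 1) / q k) \<longlonglongrightarrow> - A W"
        unfolding E_def A_def
      proof (rule tendsto_quotient[of W e "1 / m" M])
        show "1 / m * \<bar>z \<bullet> e\<bar> \<le> norm (W z)" for z
          using m(2)[of "W z"] inv(2)[of z] Basis_le_norm[OF e, of z] m(1) by (simp add: field_simps)
      qed (use e q m M lin in \<open>auto simp: mult.commute intro: linear_borel_measurable\<close>)
      have nz: "norm (W' \<xi>) > 0" if "\<xi> \<in> sphere 0 1" for \<xi>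
      proof -
        have "W' \<xi> \<noteq> 0"
        proof
          assume "W' \<xi> = 0"
          then have "\<xi> \<bullet> \<xi> = 0" using adj[of "V \<xi>" \<xi>] inv by simp
          with that show False by simp
        qed
        then show ?thesis by simp
      qed
      \<comment> \<open>Here invertibility enters: \<open>W'\<close> has no zero on the sphere, so
        the logarithm is a legitimate test function for the weak limit.\<close>
      have cont_ln: "continuous_on (sphere 0 1) (\<lambda>\<xi>. ln (norm (W' \<xi>)))"
        using lin(3) nz by (intro continuous_intros linear_continuous_on) (fastforce simp: linear_linear)+
      have PW: "(\<integral>z. N (W z) powr (- p k) \<partial>gauss_measure)
          = (\<integral>z. N z powr (- p k) \<partial>gauss_measure) * (\<integral>\<xi>. norm (W' \<xi>) powr (- p k) \<partial>P k)" for k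
        by (rule P(3)[OF lin inv adj])
      have spc: "space (P k) = sphere 0 1" for k
        using sets_eq_imp_space_eq[OF P(2)] by (simp add: space_restrict_space)
      have "(\<lambda>k. ((\<integral>\<xi>. exp (- q k * ln (norm (W' \<xi>))) \<partial>P (r k)) - 1) / q k)
          \<longlonglongrightarrow> - (\<integral>\<xi>. ln (norm (W' \<xi>)) \<partial>\<nu>)"
        by (rule quotient_integral_tendsto[OF S P(1,2) \<nu>(3)[OF cont_ln] cont_ln q(3,1)])
      moreover have "(\<integral>\<xi>. exp (- q k * ln (norm (W' \<xi>))) \<partial>P (r k)) = (\<integral>\<xi>. norm (W' \<xi>) powr (- q k) \<partial>P (r k))" for k
        by (intro Bochner_Integration.integral_cong refl) (use nz in \<open>auto simp: spc powr_def\<close>)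
      ultimately have "(\<lambda>k. E (\<lambda>z. z) k * (((\<integral>\<xi>. norm (W' \<xi>) powr (- q k) \<partial>P (r k)) - 1) / q k))
          \<longlonglongrightarrow> 1 * - (\<integral>\<xi>. ln (norm (W' \<xi>)) \<partial>\<nu>)"
        by (intro tendsto_mult E1) simp
      \<comment> \<open>The embedding identity says that \<open>E W k\<close> is \<open>E\<close> of
        the identity times the integral over the sphere; subtracting the case of the identity leaves
        the difference of two Gaussian difference quotients.\<close>
      moreover have "E (\<lambda>z. z) k * (((\<integral>\<xi>. norm (W' \<xi>) powr (- q k) \<partial>P (r k)) - 1) / q k)
          = (E W k - 1) / q k - (E (\<lambda>z. z) k - 1) / q k" for k
        using PW[of "r k"] q(1)[of k] unfolding E_def q_def[symmetric] by (simp add: field_simps)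
      ultimately have "(\<lambda>k. (E W k - 1) / q k - (E (\<lambda>z. z) k - 1) / q k)
          \<longlonglongrightarrow> - (\<integral>\<xi>. ln (norm (W' \<xi>)) \<partial>\<nu>)" by simp
      from LIMSEQ_unique[OF this tendsto_diff[OF lim_W lim_id]]
      show "(\<integral>z. ln (N (W z)) \<partial>gauss_measure) = (\<integral>z. ln (N z) \<partial>gauss_measure) + (\<integral>\<xi>. ln (norm (W' \<xi>)) \<partial>\<nu>)"
        unfolding A_def by simp
    qed (fact \<nu>)+
  qed
qed

end

text \<open>The functions \<open>r j\<close> decrease to \<open>|(\<xi>, x0)|\<close>. Finiteness of the limit \<open>l\<close> forces \<open>\<nu>\<close> not to charge
  the hyperplane orthogonal to \<open>x0\<close>, where \<open>ln (r j)\<close> tends to \<open>-\<infinity>\<close>.\<close>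

lemma log_integral_limit:
  fixes \<nu> :: "(real^'n) measure" and x0 :: "real^'n" and r :: "nat \<Rightarrow> real^'n \<Rightarrow> real"
  assumes \<nu>: "prob_space \<nu>" "sets \<nu> = sets (restrict_space borel (sphere 0 1))"
    and x0: "x0 \<noteq> 0" and r0: "\<And>j \<xi>. 0 \<le> r j \<xi>"
    and r: "\<And>j \<xi>. (r j \<xi>)\<^sup>2 = (norm x0 / Suc j)\<^sup>2 * ((norm \<xi>)\<^sup>2 - (\<xi> \<bullet> x0)\<^sup>2 / (norm x0)\<^sup>2) + (\<xi> \<bullet> x0)\<^sup>2"
    and lim: "(\<lambda>j. \<integral>\<xi>. ln (r j \<xi>) \<partial>\<nu>) \<longlonglongrightarrow> l"
  shows "AE \<xi> in \<nu>. \<xi> \<bullet> x0 \<noteq> 0" "integrable \<nu> (\<lambda>\<xi>. ln \<bar>\<xi> \<bullet> x0\<bar>)" "(\<integral>\<xi>. ln \<bar>\<xi> \<bullet> x0\<bar> \<partial>\<nu>) = l"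
proof -
  interpret prob_space \<nu> by fact
  define a where "a = norm x0"
  have a: "a > 0" using x0 by (simp add: a_def)
  have space: "space \<nu> = sphere 0 1"
    using sets_eq_imp_space_eq[OF \<nu>(2)] by (simp add: space_restrict_space)
  have meas: "f \<in> borel_measurable \<nu>" if "f \<in> borel_measurable borel" for f :: "real^'n \<Rightarrow> real"
    using measurable_restrict_space1[OF that] measurable_cong_sets[OF \<nu>(2) refl] by blast
  have cs: "(\<xi> \<bullet> x0)\<^sup>2 \<le> a\<^sup>2" if "\<xi> \<in> sphere 0 1" for \<xi>
  proof -
    have "\<bar>\<xi> \<bullet> x0\<bar> \<le> a" using Cauchy_Schwarz_ineq2[of \<xi> x0] that by (simp add: a_def)
    then show ?thesis by (metis abs_ge_zero power2_abs power_mono)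
  qed
  have r': "(r j \<xi>)\<^sup>2 = (a\<^sup>2 - (\<xi> \<bullet> x0)\<^sup>2) / (Suc j)\<^sup>2 + (\<xi> \<bullet> x0)\<^sup>2" if "\<xi> \<in> sphere 0 1" for j \<xi>
  proof -
    have "(a / real (Suc j))\<^sup>2 * (1 - (\<xi> \<bullet> x0)\<^sup>2 / a\<^sup>2) = (a\<^sup>2 - (\<xi> \<bullet> x0)\<^sup>2) / (real (Suc j))\<^sup>2"
      using a by (simp add: power_divide right_diff_distrib diff_divide_distrib)
    then show ?thesis using r[of j \<xi>] that unfolding a_def[symmetric] by simp
  qed
  have pos: "0 < (a\<^sup>2 - (\<xi> \<bullet> x0)\<^sup>2) / (Suc j)\<^sup>2 + (\<xi> \<bullet> x0)\<^sup>2" if "\<xi> \<in> sphere 0 1" for j \<xi>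
    using a cs[OF that] by (cases "\<xi> \<bullet> x0 = 0") (auto intro: add_nonneg_pos)
  have rpos: "0 < r j \<xi>" if "\<xi> \<in> sphere 0 1" for j \<xi>
    using pos[OF that, of j] r'[OF that, of j] r0[of j \<xi>] by (metis less_le power_zero_numeral)
  have rsqrt: "r j \<xi> = sqrt ((a\<^sup>2 - (\<xi> \<bullet> x0)\<^sup>2) / (Suc j)\<^sup>2 + (\<xi> \<bullet> x0)\<^sup>2)" if "\<xi> \<in> sphere 0 1" for j \<xi>
    using r'[OF that, of j] r0[of j \<xi>] by (metis real_sqrt_unique)
  \<comment> \<open>The sign is reversed because monotone convergence is applied to an increasing
    sequence.\<close>
  define u where "u j \<xi> = - ln (r j \<xi>)" for j \<xi>
  have cont: "continuous_on (sphere 0 1) (u j)" for j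
  proof -
    have "continuous_on (sphere 0 1) (\<lambda>\<xi>. - ln (sqrt ((a\<^sup>2 - (\<xi> \<bullet> x0)\<^sup>2) / (Suc j)\<^sup>2 + (\<xi> \<bullet> x0)\<^sup>2)))"
      using pos[of _ j] by (intro continuous_intros) (auto dest!: pos[of _ j])
    then show ?thesis by (rule continuous_on_eq) (simp add: u_def rsqrt)
  qed
  have ui: "integrable \<nu> (u j)" for j
    by (rule integrable_continuous_on_compact[OF _ \<nu> cont]) simp
  have ulim: "(\<lambda>j. integral\<^sup>L \<nu> (u j)) \<longlonglongrightarrow> - l"
  proof -
    have "integral\<^sup>L \<nu> (u j) = - (\<integral>\<xi>. ln (r j \<xi>) \<partial>\<nu>)" for j by (simp add: u_def[abs_def])
    then show ?thesis using tendsto_minus[OF lim] by simp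
  qed
  have rle: "r j \<xi> \<le> a" if "\<xi> \<in> sphere 0 1" for j \<xi>
  proof (rule power2_le_imp_le)
    have "(a\<^sup>2 - (\<xi> \<bullet> x0)\<^sup>2) / (Suc j)\<^sup>2 \<le> (a\<^sup>2 - (\<xi> \<bullet> x0)\<^sup>2) / 1"
      using cs[OF that] by (intro divide_left_mono) auto
    then show "(r j \<xi>)\<^sup>2 \<le> a\<^sup>2" using r'[OF that] by simp
  qed (use a in auto)
  let ?Z = "{\<xi> \<in> space \<nu>. \<xi> \<bullet> x0 = 0}"
  have Zm: "?Z \<in> sets \<nu>"
  proof -
    have "?Z = (\<lambda>\<xi>. \<xi> \<bullet> x0) -` {0} \<inter> space \<nu>" by auto
    also have "\<dots> \<in> sets \<nu>" by (intro measurable_sets[where A = borel] meas) auto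
    finally show ?thesis .
  qed
  \<comment> \<open>On \<open>?Z\<close> one has \<open>r j\<close> = a / (j + 1), so
    \<open>u j\<close> + ln a equals ln (j + 1) there; elsewhere it is nonnegative, as
    \<open>r j\<close> is at most a. The integrals on the right converge, hence stay bounded, and
    \<open>?Z\<close> must be null.\<close>
  have "ln (Suc j) * measure \<nu> ?Z \<le> integral\<^sup>L \<nu> (u j) + ln a" for j
  proof -
    have "ln (Suc j) * measure \<nu> ?Z = (\<integral>\<xi>. ln (Suc j) * indicator ?Z \<xi> \<partial>\<nu>)"
      using Zm by simp
    also have "\<dots> \<le> (\<integral>\<xi>. u j \<xi> + ln a \<partial>\<nu>)"
    proof (rule integral_mono)
      show "integrable \<nu> (\<lambda>\<xi>. ln (Suc j) * indicator ?Z \<xi>)"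
        using Zm by (intro Bochner_Integration.integrable_mult_right) (auto simp: emeasure_eq_measure)
      show "integrable \<nu> (\<lambda>\<xi>. u j \<xi> + ln a)" by (intro Bochner_Integration.integrable_add ui) simp
      fix \<xi> assume "\<xi> \<in> space \<nu>"
      then have \<xi>: "\<xi> \<in> sphere 0 1" by (simp add: space)
      show "ln (Suc j) * indicator ?Z \<xi> \<le> u j \<xi> + ln a"
      proof (cases "\<xi> \<in> ?Z")
        case True
        then have "r j \<xi> = a / Suc j" using rsqrt[OF \<xi>, of j] a by (simp add: real_sqrt_divide)
        then show ?thesis using True a by (simp add: u_def ln_div)
      next
        case False
        then show ?thesis using rle[OF \<xi>, of j] rpos[OF \<xi>, of j] a by (simp add: u_def)
      qed
    qed
    also have "\<dots> = integral\<^sup>L \<nu> (u j) + ln a" using ui prob_space by simp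
    finally show ?thesis .
  qed
  moreover have "(\<lambda>j. integral\<^sup>L \<nu> (u j) + ln a) \<longlonglongrightarrow> - l + ln a" by (intro tendsto_intros ulim)
  then have "Bseq (\<lambda>j. integral\<^sup>L \<nu> (u j) + ln a)" by (intro convergent_imp_Bseq convergentI)
  then obtain D where D: "\<And>j. \<bar>integral\<^sup>L \<nu> (u j) + ln a\<bar> \<le> D" unfolding Bseq_def by auto
  ultimately have bd: "ln (Suc j) * measure \<nu> ?Z \<le> D" for j by (meson abs_le_D1 order_trans)
  have "measure \<nu> ?Z = 0"
  proof (rule ccontr)
    assume "measure \<nu> ?Z \<noteq> 0"
    then have pZ: "measure \<nu> ?Z > 0" by (simp add: less_le)
    have "filterlim (\<lambda>j. ln (real (Suc j))) at_top sequentially"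
      by (rule filterlim_compose[OF ln_at_top])
        (rule filterlim_compose[OF filterlim_real_sequentially filterlim_Suc])
    then have "\<forall>\<^sub>F j in sequentially. D / measure \<nu> ?Z < ln (real (Suc j))"
      by (simp add: filterlim_at_top_dense)
    then obtain j where "D / measure \<nu> ?Z < ln (real (Suc j))" by (auto dest: eventually_happens)
    with bd[of j] pZ show False by (simp add: field_simps)
  qed
  then have "emeasure \<nu> ?Z = 0" by (simp add: emeasure_eq_measure)
  then show AE: "AE \<xi> in \<nu>. \<xi> \<bullet> x0 \<noteq> 0" using Zm by (subst AE_iff_measurable[of ?Z]) auto
  have mono: "AE \<xi> in \<nu>. mono (\<lambda>j. u j \<xi>)"
  proof (rule AE_I2)
    fix \<xi> assume "\<xi> \<in> space \<nu>"
    then have \<xi>: "\<xi> \<in> sphere 0 1" by (simp add: space)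
    show "mono (\<lambda>j. u j \<xi>)"
    proof (rule monoI)
      fix i j :: nat assume "i \<le> j"
      then have "(a\<^sup>2 - (\<xi> \<bullet> x0)\<^sup>2) / (Suc j)\<^sup>2 \<le> (a\<^sup>2 - (\<xi> \<bullet> x0)\<^sup>2) / (Suc i)\<^sup>2"
        using cs[OF \<xi>] by (intro divide_left_mono power_mono) auto
      then have "r j \<xi> \<le> r i \<xi>" using rsqrt[OF \<xi>] by simp
      then show "u i \<xi> \<le> u j \<xi>" using rpos[OF \<xi>] by (simp add: u_def)
    qed
  qed
  have ptw: "AE \<xi> in \<nu>. (\<lambda>j. u j \<xi>) \<longlonglongrightarrow> - ln \<bar>\<xi> \<bullet> x0\<bar>"
    using AE AE_space
  proof eventually_elim
    case (elim \<xi>)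
    then have \<xi>: "\<xi> \<in> sphere 0 1" by (simp add: space)
    have "(\<lambda>j. (a\<^sup>2 - (\<xi> \<bullet> x0)\<^sup>2) * (inverse (real (Suc j)))\<^sup>2 + (\<xi> \<bullet> x0)\<^sup>2) \<longlonglongrightarrow> (a\<^sup>2 - (\<xi> \<bullet> x0)\<^sup>2) * 0\<^sup>2 + (\<xi> \<bullet> x0)\<^sup>2"
      by (intro tendsto_intros LIMSEQ_inverse_real_of_nat)
    then have "(\<lambda>j. sqrt ((a\<^sup>2 - (\<xi> \<bullet> x0)\<^sup>2) * (inverse (real (Suc j)))\<^sup>2 + (\<xi> \<bullet> x0)\<^sup>2)) \<longlonglongrightarrow> \<bar>\<xi> \<bullet> x0\<bar>"
      using tendsto_real_sqrt by fastforce
    then have "(\<lambda>j. r j \<xi>) \<longlonglongrightarrow> \<bar>\<xi> \<bullet> x0\<bar>"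
      unfolding rsqrt[OF \<xi>] by (simp add: divide_inverse power_inverse)
    then show ?case unfolding u_def using elim by (intro tendsto_minus tendsto_ln) auto
  qed
  have m: "(\<lambda>\<xi>. - ln \<bar>\<xi> \<bullet> x0\<bar>) \<in> borel_measurable \<nu>" by (rule meas) measurable
  have "integrable \<nu> (\<lambda>\<xi>. - ln \<bar>\<xi> \<bullet> x0\<bar>)"
    by (rule integrable_monotone_convergence[OF ui mono ptw ulim m])
  then show "integrable \<nu> (\<lambda>\<xi>. ln \<bar>\<xi> \<bullet> x0\<bar>)" by simp
  have "(\<integral>\<xi>. - ln \<bar>\<xi> \<bullet> x0\<bar> \<partial>\<nu>) = - l"
    by (rule integral_monotone_convergence[OF ui mono ptw ulim m])
  then show "(\<integral>\<xi>. ln \<bar>\<xi> \<bullet> x0\<bar> \<partial>\<nu>) = l" by simp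
qed

theorem theorem6p4:
  fixes K :: "(real^'n) set" and \<epsilon> :: real
  assumes "symmetric_star_body K"
    and "0 < \<epsilon>" and "\<epsilon> < real CARD('n)"
    and "\<And>p. 0 < p \<Longrightarrow> p < \<epsilon> \<Longrightarrow> embeds_in_L_neg K p"
  shows "embeds_in_L0 K"
proof -
  obtain c C where "gauge (minkowski_functional K) c C"
    using symmetric_star_body_gauge[OF assms(1)] unfolding gauge_def by metis
  then interpret gauge "minkowski_functional K" c C .
  let ?N = "minkowski_functional K"
  have "\<exists>\<mu>::(real^'n) measure. finite_sphere_measure \<mu> \<and>
      (\<forall>\<phi>. schwartz_function \<phi> \<longrightarrow> (LINT x|lborel. (?N x powr (-p)) *\<^sub>R \<phi> x) =
        (LINT \<xi>|\<mu>. (LINT t|lborel. (\<bar>t\<bar> powr (p - 1)) *\<^sub>R fourier_transform \<phi> (t *\<^sub>R \<xi>))))"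
    if "0 < p" "p < \<epsilon>" for p
    using assms(4)[OF that] unfolding embeds_in_L_neg_def by blast
  from limit_measure[OF assms(2) this] obtain \<nu> :: "(real^'n) measure" where \<nu>: "prob_space \<nu>"
    "sets \<nu> = sets (restrict_space borel (sphere 0 1))"
    "\<And>(W :: real^'n \<Rightarrow> real^'n) V W'. linear W \<Longrightarrow> linear V \<Longrightarrow> linear W' \<Longrightarrow> (\<And>x. W (V x) = x) \<Longrightarrow> (\<And>x. V (W x) = x) \<Longrightarrow>
      (\<And>z \<xi>. W z \<bullet> \<xi> = z \<bullet> W' \<xi>) \<Longrightarrow>
      (\<integral>z. ln (?N (W z)) \<partial>gauss_measure) = (\<integral>z. ln (?N z) \<partial>gauss_measure) + (\<integral>\<xi>. ln (norm (W' \<xi>)) \<partial>\<nu>)"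
    by blast
  interpret \<nu>: prob_space \<nu> by fact
  obtain e :: "real^'n" where e: "e \<in> Basis" using nonempty_Basis by blast
  then have ne: "norm e = 1" by simp
  \<comment> \<open>The additive constant of the representation; it involves the auxiliary vector
    \<open>e\<close> but not x.\<close>
  define D where "D = (\<integral>z. ln (?N z) \<partial>gauss_measure) - (\<integral>z. ln \<bar>z \<bullet> e\<bar> \<partial>gauss_measure)"
  have "ext_ln (?N x) = ext_integral \<nu> (\<lambda>\<xi>. ext_ln \<bar>x \<bullet> \<xi>\<bar>) + ereal D" for x
  proof (cases "x = 0")
    \<comment> \<open>Both sides are -\<infinity>, the right one because \<nu> has mass 1; a zero
      measure would give the integral 0.\<close>
    case True
    have "?N 0 = 0" using hom[of 0 0] by simp
    then show ?thesis using True \<nu>.emeasure_space_1 by (simp add: ext_ln_def ext_integral_def e2ennreal_neg zero_ennreal.rep_eq)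
  next
    case False
    show ?thesis
    proof (rule stretch_map[OF False ne])
      fix W V W' :: "real \<Rightarrow> real^'n \<Rightarrow> real^'n"
      assume
        lin: "\<And>h. h > 0 \<Longrightarrow> linear (W h)" "\<And>h. h > 0 \<Longrightarrow> linear (V h)" "\<And>h. h > 0 \<Longrightarrow> linear (W' h)" and
        inv: "\<And>h x. h > 0 \<Longrightarrow> W h (V h x) = x" "\<And>h x. h > 0 \<Longrightarrow> V h (W h x) = x" and
        adj: "\<And>h z \<xi>. h > 0 \<Longrightarrow> W h z \<bullet> \<xi> = z \<bullet> W' h \<xi>" and
        nW: "\<And>h z. h > 0 \<Longrightarrow> (norm (W h z))\<^sup>2 = h\<^sup>2 * ((norm z)\<^sup>2 - (z \<bullet> e)\<^sup>2) + (norm x)\<^sup>2 * (z \<bullet> e)\<^sup>2" and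
        nW': "\<And>h \<xi>. h > 0 \<Longrightarrow> (norm (W' h \<xi>))\<^sup>2 = h\<^sup>2 * ((norm \<xi>)\<^sup>2 - (\<xi> \<bullet> x)\<^sup>2 / (norm x)\<^sup>2) + (\<xi> \<bullet> x)\<^sup>2" and
        close: "\<And>h z. h > 0 \<Longrightarrow> norm (W h z - (z \<bullet> e) *\<^sub>R x) \<le> 2 * h * norm z"
      \<comment> \<open>With h at most |x| the stretched maps satisfy |x| |(z, e)| \<le> |W z| \<le>
        |x| |z|, the two-sided bound of \<open>tendsto_log_integral\<close> with both constants
        equal to |x|.\<close>
      define h where "h j = norm x / Suc j" for j
      have h: "h j > 0" "h j \<le> norm x" for j using False by (simp_all add: h_def field_simps)
      have hlim: "h \<longlonglongrightarrow> 0"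
        unfolding h_def using tendsto_mult_right_zero[OF LIMSEQ_inverse_real_of_nat, of "norm x"]
        by (simp add: divide_inverse)
      have sq: "(z \<bullet> e)\<^sup>2 \<le> (norm z)\<^sup>2" for z
        using Basis_le_norm[OF e, of z] by (metis abs_ge_zero power2_abs power_mono)
      have "(\<lambda>j. \<integral>z. ln (?N (W (h j) z)) \<partial>gauss_measure)
        \<longlonglongrightarrow> ln (?N x) + (\<integral>z. ln \<bar>z \<bullet> e\<bar> \<partial>gauss_measure)"
      proof (rule tendsto_log_integral[OF _ e, of _ "norm x" "norm x"])
        show "W (h j) \<in> borel_measurable borel" for j by (intro linear_borel_measurable lin h)
        show "norm x * \<bar>z \<bullet> e\<bar> \<le> norm (W (h j) z)" for j z
        proof (rule power2_le_imp_le)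
          show "(norm x * \<bar>z \<bullet> e\<bar>)\<^sup>2 \<le> (norm (W (h j) z))\<^sup>2"
            unfolding nW[OF h(1)] using sq[of z] by (simp add: power_mult_distrib)
        qed simp
        show "norm (W (h j) z) \<le> norm x * norm z" for j z
        proof (rule power2_le_imp_le)
          have "(h j)\<^sup>2 * ((norm z)\<^sup>2 - (z \<bullet> e)\<^sup>2) \<le> (norm x)\<^sup>2 * ((norm z)\<^sup>2 - (z \<bullet> e)\<^sup>2)"
            using h[of j] sq[of z] by (intro mult_right_mono power_mono) auto
          then show "(norm (W (h j) z))\<^sup>2 \<le> (norm x * norm z)\<^sup>2"
            unfolding nW[OF h(1)] by (simp add: power_mult_distrib algebra_simps)
        qed simp
        show "(\<lambda>j. W (h j) z) \<longlonglongrightarrow> (z \<bullet> e) *\<^sub>R x" for z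
        proof (rule LIM_zero_cancel, rule Lim_null_comparison)
          show "\<forall>\<^sub>F j in sequentially. norm (W (h j) z - (z \<bullet> e) *\<^sub>R x) \<le> 2 * h j * norm z"
            using close[OF h(1)] by (intro always_eventually allI)
          show "(\<lambda>j. 2 * h j * norm z) \<longlonglongrightarrow> 0"
            by (intro tendsto_mult_left_zero tendsto_mult_right_zero hlim)
        qed
      qed (use False in auto)
      moreover have "(\<integral>z. ln (?N (W (h j) z)) \<partial>gauss_measure)
          = (\<integral>z. ln (?N z) \<partial>gauss_measure) + (\<integral>\<xi>. ln (norm (W' (h j) \<xi>)) \<partial>\<nu>)" for j
        by (rule \<nu>(3)[OF lin(1,2,3) inv(1,2) adj]) (rule h)+
      ultimately have "(\<lambda>j. (\<integral>z. ln (?N z) \<partial>gauss_measure) + (\<integral>\<xi>. ln (norm (W' (h j) \<xi>)) \<partial>\<nu>))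
        \<longlonglongrightarrow> ln (?N x) + (\<integral>z. ln \<bar>z \<bullet> e\<bar> \<partial>gauss_measure)" by simp
      from tendsto_diff[OF this tendsto_const[of "\<integral>z. ln (?N z) \<partial>gauss_measure"]]
      have "(\<lambda>j. \<integral>\<xi>. ln (norm (W' (h j) \<xi>)) \<partial>\<nu>) \<longlonglongrightarrow> ln (?N x) - D" by (simp add: D_def algebra_simps)
      note l = log_integral_limit[OF \<nu>(1,2) False _ _ this]
      have nW'': "(norm (W' (h j) \<xi>))\<^sup>2
        = (norm x / Suc j)\<^sup>2 * ((norm \<xi>)\<^sup>2 - (\<xi> \<bullet> x)\<^sup>2 / (norm x)\<^sup>2) + (\<xi> \<bullet> x)\<^sup>2" for j \<xi>
        using nW'[OF h(1)] unfolding h_def .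
      note l = l[OF norm_ge_zero nW'']
      \<comment> \<open>The hyperplane orthogonal to x is a null set, so the extended logarithm is
        almost everywhere the real one.\<close>
      have "ext_integral \<nu> (\<lambda>\<xi>. ext_ln \<bar>x \<bullet> \<xi>\<bar>) = ereal (\<integral>\<xi>. ln \<bar>\<xi> \<bullet> x\<bar> \<partial>\<nu>)"
        by (rule ext_integral_eq_integral[OF l(2)])
          (use l(1) in \<open>eventually_elim, simp add: ext_ln_def inner_commute\<close>)
      moreover have "ext_ln (?N x) = ereal (ln (?N x))" using pos[OF False] by (simp add: ext_ln_def)
      ultimately show ?thesis using l(3) by simp
    qed
  qed
  moreover have "finite_sphere_measure \<nu>"
    unfolding finite_sphere_measure_def using \<nu>(2) \<nu>.finite_measure_axioms by blast
  ultimately show ?thesis unfolding embeds_in_L0_def by blast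
qed

end
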